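(* Let $G$ be a finite group acting linearly on a finite-dimensional complex vector space $V$. Let $I\subseteq\mathbb{R}$ be an open interval and $c:I\to V/\!\!/G=\sigma(V)\subseteq\mathbb{C}^n$ a curve of class $C^D$. Then there exists a global differentiable curve $\bar c:I\to V$ with $\sigma\circ\bar c=c$ if and only if $c$ is $1$-flat at every $t\in I$.
   Context: For a finite group $H$ acting linearly on a complex vector space $W$, choose a minimal system of homogeneous generators of $\mathbb{C}[W]^H$ and let $d(W,H)$ be the maximum of their degrees. Here $\sigma=(\sigma_1,\dots,\sigma_n)$ for a minimal system of homogeneous generators $\sigma_1,\dots,\sigma_n$ of $\mathbb{C}[V]^G$, and $V/\!\!/G$ is identified with $\sigma(V)$. Let $D$ be the maximum of $d(V,G_v)$ over all $v\in V$, where $G_v$ is the isotropy group of $v$ (for finite $G$ the slice representation at $v$ is $G_v$ acting on $V$). 1-flatness: let $t\in I$ and $v\in\sigma^{-1}(c(t))$. Let $\tau_1,\dots,\tau_m$ be a minimal system of homogeneous generators of $\mathbb{C}[V]^{G_v}$ with degrees $d'_1,\dots,d'_m$, and $\tau=(\tau_1,\dots,\tau_m):V\to\mathbb{C}^m$. By Luna's slice theorem there is a $G_v$-invariant open neighborhood $S$ of $0$ in $V$ such that $\tau(x)\mapsto\sigma(v+x)$ ($x\in S$) is a well-defined homeomorphism $\Phi$ from $\tau(S)$ onto an open neighborhood of $c(t)$ in $\sigma(V)$, with $\Phi(0)=c(t)$. The curve $c$ is $1$-flat at $t$ if, for $s$ near $t$, $\Phi^{-1}(c(s))=\big((s-t)^{d'_1}a_1(s),\dots,(s-t)^{d'_m}a_m(s)\big)$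 for some continuous functions $a_1,\dots,a_m$ defined near $t$. *)

theory Defs
  imports "HOL-Analysis.Analysis"
begin

text \<open>The vector space V is complex^'n; a finite group acting linearly on V is
  represented by its (finite) image, a finite group of complex matrices acting by *v.\<close>

definition finite_matrix_group :: "(complex^'n^'n) set \<Rightarrow> bool" where
  "finite_matrix_group G \<longleftrightarrow> finite G \<and> mat 1 \<in> G \<and>
     (\<forall>g\<in>G. \<forall>h\<in>G. g ** h \<in> G) \<and>
     (\<forall>g\<in>G. invertible g \<and> matrix_inv g \<in> G)"

definition stab :: "(complex^'n^'n) set \<Rightarrow> complex^'n \<Rightarrow> (complex^'n^'n) set" where
  "stab G v = {g \<in> G. g *v v = v}"

definition monom :: "('n::finite \<Rightarrow> nat) \<Rightarrow> complex^'n \<Rightarrow> complex" where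
  "monom \<alpha> x = (\<Prod>i\<in>UNIV. (x $ i) ^ (\<alpha> i))"

definition poly_fun :: "(complex^'n::finite \<Rightarrow> complex) \<Rightarrow> bool" where
  "poly_fun f \<longleftrightarrow> (\<exists>A a. finite A \<and> f = (\<lambda>x. \<Sum>\<alpha>\<in>A. a \<alpha> * monom \<alpha> x))"

definition hom_poly_fun :: "nat \<Rightarrow> (complex^'n::finite \<Rightarrow> complex) \<Rightarrow> bool" where
  "hom_poly_fun d f \<longleftrightarrow> (\<exists>A a. finite A \<and> (\<forall>\<alpha>\<in>A. sum \<alpha> UNIV = d) \<and>
      f = (\<lambda>x. \<Sum>\<alpha>\<in>A. a \<alpha> * monom \<alpha> x))"

text \<open>Degree of a (nonzero) homogeneous polynomial function.\<close>
definition hdeg :: "(complex^'n::finite \<Rightarrow> complex) \<Rightarrow> nat" where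
  "hdeg f = (THE d. hom_poly_fun d f)"

definition inv_poly :: "(complex^'n^'n) set \<Rightarrow> (complex^'n::finite \<Rightarrow> complex) \<Rightarrow> bool" where
  "inv_poly G f \<longleftrightarrow> poly_fun f \<and> (\<forall>g\<in>G. \<forall>x. f (g *v x) = f x)"

definition in_alg :: "'i set \<Rightarrow> ('i \<Rightarrow> complex^'n \<Rightarrow> complex) \<Rightarrow> (complex^'n \<Rightarrow> complex) \<Rightarrow> bool" where
  "in_alg A f h \<longleftrightarrow> (\<exists>B b. finite B \<and>
      h = (\<lambda>x. \<Sum>\<beta>\<in>B. b \<beta> * (\<Prod>i\<in>A. (f i x) ^ (\<beta> i))))"

definition hom_gens :: "(complex^'n^'n) set \<Rightarrow> 'i set \<Rightarrow> ('i \<Rightarrow> complex^'n::finite \<Rightarrow> complex) \<Rightarrow> bool" where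
  "hom_gens G A f \<longleftrightarrow> finite A \<and>
     (\<forall>i\<in>A. inv_poly G (f i) \<and> (\<exists>d. hom_poly_fun d (f i))) \<and>
     (\<forall>h. inv_poly G h \<longrightarrow> in_alg A f h)"

definition min_hom_gens :: "(complex^'n^'n) set \<Rightarrow> 'i set \<Rightarrow> ('i \<Rightarrow> complex^'n::finite \<Rightarrow> complex) \<Rightarrow> bool" where
  "min_hom_gens G A f \<longleftrightarrow> hom_gens G A f \<and> (\<forall>B. B \<subset> A \<longrightarrow> \<not> hom_gens G B f)"

text \<open>d(V,H): maximal degree of a minimal system of homogeneous generators
  (independent of the chosen system).\<close>
definition d_inv :: "(complex^'n::finite^'n) set \<Rightarrow> nat" where
  "d_inv H = Max {hdeg (f i) | (A :: nat set) f i. min_hom_gens H A f \<and> i \<in> A}"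

definition D_max :: "(complex^'n::finite^'n) set \<Rightarrow> nat" where
  "D_max G = Max ((\<lambda>v. d_inv (stab G v)) ` UNIV)"

definition Ck_on :: "nat \<Rightarrow> real set \<Rightarrow> (real \<Rightarrow> 'a::real_normed_vector) \<Rightarrow> bool" where
  "Ck_on k I c \<longleftrightarrow> (\<exists>F :: nat \<Rightarrow> real \<Rightarrow> 'a. (\<forall>t\<in>I. F 0 t = c t) \<and>
     (\<forall>j<k. \<forall>t\<in>I. (F j has_vector_derivative F (Suc j) t) (at t)) \<and>
     continuous_on I (F k))"

text \<open>tau(x) = (tau_1 x, ..., tau_m x) in C^m, represented as nat => complex
  padded by zeros.\<close>
definition tauvec :: "nat \<Rightarrow> (nat \<Rightarrow> complex^'n \<Rightarrow> complex) \<Rightarrow> complex^'n \<Rightarrow> (nat \<Rightarrow> complex)" where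
  "tauvec m \<tau> x = (\<lambda>i. if i < m then \<tau> i x else 0)"

definition slice_chart ::
  "(complex^'n^'n) set \<Rightarrow> (complex^'n::finite \<Rightarrow> complex^'m) \<Rightarrow> complex^'n \<Rightarrow> nat \<Rightarrow>
   (nat \<Rightarrow> complex^'n \<Rightarrow> complex) \<Rightarrow> (complex^'n) set \<Rightarrow>
   ((nat \<Rightarrow> complex) \<Rightarrow> complex^'m) \<Rightarrow> (complex^'m \<Rightarrow> (nat \<Rightarrow> complex)) \<Rightarrow> bool" where
  "slice_chart G \<sigma> v m \<tau> S \<Phi> \<Psi> \<longleftrightarrow>
     open S \<and> 0 \<in> S \<and> (\<forall>g\<in>stab G v. \<forall>x\<in>S. g *v x \<in> S) \<and>
     (\<forall>x\<in>S. \<Phi> (tauvec m \<tau> x) = \<sigma> (v + x)) \<and>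
     (\<exists>U. openin (top_of_set (range \<sigma>)) U \<and> \<sigma> v \<in> U \<and>
          homeomorphism (tauvec m \<tau> ` S) U \<Phi> \<Psi>)"

definition one_flat ::
  "(complex^'n^'n) set \<Rightarrow> (complex^'n::finite \<Rightarrow> complex^'m) \<Rightarrow> real set \<Rightarrow>
   (real \<Rightarrow> complex^'m) \<Rightarrow> real \<Rightarrow> bool" where
  "one_flat G \<sigma> I c t \<longleftrightarrow>
     (\<forall>v m \<tau> S \<Phi> \<Psi>. \<sigma> v = c t \<longrightarrow> min_hom_gens (stab G v) {..<m} \<tau> \<longrightarrow>
        slice_chart G \<sigma> v m \<tau> S \<Phi> \<Psi> \<longrightarrow>
        (\<exists>e>0. \<exists>a :: nat \<Rightarrow> real \<Rightarrow> complex.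
           (\<forall>i<m. continuous_on (ball t e \<inter> I) (a i)) \<and>
           (\<forall>s\<in>ball t e \<inter> I. \<Psi> (c s) =
              (\<lambda>i. if i < m then (complex_of_real (s - t)) ^ hdeg (\<tau> i) * a i s else 0))))"

end

theory Submission
  imports Defs
begin

text \<open>
  The values of \<open>\<sigma>\<close> are in bijection with the orbits of \<open>G\<close>, and \<open>\<sigma>\<close> is proper because a point
  at which all homogeneous invariants take the values they have at \<open>0\<close> is \<open>0\<close>. Hence, by
  dividing out powers of \<open>s - t\<close>, 1-flatness at \<open>t\<close> means that some lift of the curve, not
  even continuous away from \<open>t\<close>, is differentiable at \<open>t\<close>.

  These pointwise lifts are patched by induction on the order of \<open>G\<close>. Let \<open>E\<close> be the set of
  parameters at which the curve meets the image of the fixed point space. Off \<open>E\<close>, a slice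
  reduces the problem to a smaller isotropy group. At an isolated point of \<open>E\<close> every
  differentiable lift on one side has a one-sided derivative, and the two sides are matched by a
  group element. At an accumulation point of \<open>E\<close> the derivative of a pointwise lift is fixed by
  \<open>G\<close>, so every lift is differentiable there.
\<close>

section \<open>Finite matrix groups and their orbits\<close>

text \<open>The obstacle is that lifts chosen at different parameters are related by group elements
  that depend on the parameter without any continuity, and that derivatives of lifts need not be
  continuous. Finiteness of the group replaces continuity: if two lifts are differentiable at
  \<open>t\<close>, a single group element relates them on a set of parameters accumulating at
  \<open>t\<close>, and it then carries value to value and derivative to derivative. To exploit this
  without invariant theory, lifts are compared with an arbitrary choice \<open>x\<^sub>0\<close> of
  orbit representatives on which no regularity is imposed; the invariants enter in the translation
  from and to 1-flatness. There \<open>one_flat\<close> speaks of all minimal systems of generators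
  and all slice charts, so to draw anything from it as a hypothesis, one system and one chart must
  be exhibited. This is why finite generation of the invariants (Noether's argument, with averaging)
  and the slice theorem for finite groups are proved here.\<close>

definition orb :: "(complex^'n^'n) set \<Rightarrow> complex^'n \<Rightarrow> complex^'n \<Rightarrow> bool" where
  "orb G x y \<longleftrightarrow> (\<exists>g\<in>G. y = g *v x)"

lemma finite_matrix_group_finite: "finite_matrix_group G \<Longrightarrow> finite G"
  by (simp add: finite_matrix_group_def)

lemma finite_matrix_group_inverse:
  assumes "finite_matrix_group G" "g \<in> G"
  obtains h where "h \<in> G" "h ** g = mat 1" "g ** h = mat 1"
    "\<And>x. h *v (g *v x) = x" "\<And>x. g *v (h *v x) = x"
proof -
  have inv: "invertible g" and mem: "matrix_inv g \<in> G"
    using assms by (auto simp: finite_matrix_group_def)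
  have "g ** matrix_inv g = mat 1 \<and> matrix_inv g ** g = mat 1"
    using inv unfolding invertible_def matrix_inv_def by (rule someI_ex)
  with mem that show ?thesis
    by (simp add: matrix_vector_mul_assoc)
qed

lemma finite_matrix_group_mult:
  "finite_matrix_group G \<Longrightarrow> g \<in> G \<Longrightarrow> h \<in> G \<Longrightarrow> g ** h \<in> G"
  by (simp add: finite_matrix_group_def)

lemma finite_matrix_group_one: "finite_matrix_group G \<Longrightarrow> mat 1 \<in> G"
  by (simp add: finite_matrix_group_def)

lemma finite_matrix_group_stab:
  assumes "finite_matrix_group G"
  shows "finite_matrix_group (stab G v)"
proof -
  have "matrix_inv g *v v = v" if "g \<in> G" "g *v v = v" for g
  proof -
    have "invertible g" using assms that by (simp add: finite_matrix_group_def)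
    then have "g ** matrix_inv g = mat 1 \<and> matrix_inv g ** g = mat 1"
      unfolding invertible_def matrix_inv_def by (rule someI_ex)
    then show ?thesis
      by (metis matrix_vector_mul_assoc matrix_vector_mul_lid that(2))
  qed
  then show ?thesis
    using assms by (auto simp: finite_matrix_group_def stab_def simp flip: matrix_vector_mul_assoc)
qed

lemma stab_subset: "stab G v \<subseteq> G"
  by (auto simp: stab_def)

lemma orb_refl: "finite_matrix_group G \<Longrightarrow> orb G x x"
  unfolding orb_def using finite_matrix_group_one by force

lemma orb_sym:
  assumes "finite_matrix_group G" "orb G x y"
  shows "orb G y x"
proof -
  obtain g where g: "g \<in> G" "y = g *v x" using assms(2) by (auto simp: orb_def)
  show ?thesis
    by (rule finite_matrix_group_inverse[OF assms(1) g(1)]) (metis g(2) orb_def)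
qed

lemma orb_trans:
  "finite_matrix_group G \<Longrightarrow> orb G x y \<Longrightarrow> orb G y z \<Longrightarrow> orb G x z"
  unfolding orb_def by (metis finite_matrix_group_mult matrix_vector_mul_assoc)

lemma orb_translate:
  "finite_matrix_group G \<Longrightarrow> g \<in> G \<Longrightarrow> orb G x y \<Longrightarrow> orb G x (g *v y)"
  by (rule orb_trans[where y=y]) (auto simp: orb_def)

lemma orb_mono: "H \<subseteq> G \<Longrightarrow> orb H x y \<Longrightarrow> orb G x y"
  by (auto simp: orb_def)

lemma matrix_vector_mult_scaleR_complex:
  fixes A :: "complex^'n^'m"
  shows "A *v (r *\<^sub>R x) = r *\<^sub>R (A *v x)"
  by (rule linear_scale) (auto intro: bounded_linear.linear)

lemma finite_matrix_set_bound:
  fixes G :: "(complex^'n^'m) set"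
  assumes "finite G"
  obtains M where "M > 0" "\<And>g x. g \<in> G \<Longrightarrow> norm (g *v x) \<le> M * norm x"
proof -
  define M where "M = 1 + (\<Sum>g\<in>G. onorm ((*v) g))"
  have pos: "onorm ((*v) g) \<ge> 0" for g :: "complex^'n^'m"
    by (simp add: onorm_pos_le)
  have "norm (g *v x) \<le> M * norm x" if "g \<in> G" for g x
  proof -
    have "norm (g *v x) \<le> onorm ((*v) g) * norm x"
      by (simp add: onorm)
    also have "onorm ((*v) g) \<le> M"
      unfolding M_def using member_le_sum[OF that, of "\<lambda>g. onorm ((*v) g)"] pos assms by simp
    finally show ?thesis by (simp add: mult_right_mono)
  qed
  moreover have "M > 0"
    unfolding M_def using sum_nonneg[of G "\<lambda>g. onorm ((*v) g)"] pos by (simp add: add_pos_nonneg)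
  ultimately show ?thesis using that by blast
qed

text \<open>If \<open>g\<close> moves \<open>v\<close>, then \<open>g *v v\<close> has distance at
  least \<open>d\<close> from \<open>v\<close>, whereas \<open>x\<close> and \<open>g *v x\<close>
  both near \<open>v\<close> would put it closer. This is the metric core of the slice theorem: near
  \<open>v\<close>, orbits of \<open>G\<close> are orbits of \<open>stab G v\<close>.\<close>

lemma slice_radius:
  fixes G :: "(complex^'n^'n) set"
  assumes "finite G"
  obtains r where "r > 0"
    "\<And>g x. g \<in> G \<Longrightarrow> norm (x - v) < r \<Longrightarrow> norm (g *v x - v) < r \<Longrightarrow> g *v v = v"
proof -
  obtain M where M: "M > 0" "\<And>g x. g \<in> G \<Longrightarrow> norm (g *v x) \<le> M * norm x"
    using finite_matrix_set_bound[OF assms] by blast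
  obtain d where d: "d > 0" "\<forall>x\<in>(\<lambda>g. g *v v) ` G. x \<noteq> v \<longrightarrow> d \<le> dist v x"
    using finite_set_avoid[of "(\<lambda>g. g *v v) ` G" v] assms by auto
  \<comment> \<open>Chosen so that \<open>r + M * r = d\<close>: one \<open>r\<close> bounds
    \<open>g *v x - v\<close>, and \<open>M * r\<close> bounds \<open>g *v (x - v)\<close>.\<close>
  define r where "r = d / (1 + M)"
  have r: "r > 0" "r + M * r = d"
  proof -
    have "r + M * r = r * (1 + M)" by (simp add: algebra_simps)
    then show "r > 0" "r + M * r = d" using d(1) M(1) by (simp_all add: r_def)
  qed
  have "g *v v = v" if "g \<in> G" "norm (x - v) < r" "norm (g *v x - v) < r" for g x
  proof (rule ccontr)
    assume "g *v v \<noteq> v"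
    then have "d \<le> dist v (g *v v)" using d(2) that by blast
    also have "\<dots> \<le> norm (g *v x - v) + norm (g *v (x - v))"
      by (simp add: dist_norm matrix_vector_mult_diff_distrib) norm
    also have "\<dots> < r + M * r"
      using that M(2)[of g "x - v"] M(1) by (smt (verit) mult_left_mono)
    finally show False using r(2) by simp
  qed
  with r(1) that show ?thesis by blast
qed

section \<open>Gluing differentiable lifts\<close>

lemma has_vector_derivative_quotient:
  fixes f :: "real \<Rightarrow> 'a::real_normed_vector"
  shows "(f has_vector_derivative d) (at t within A) \<longleftrightarrow>
    ((\<lambda>s. (f s - f t) /\<^sub>R (s - t)) \<longlongrightarrow> d) (at t within A)"
proof -
  have "((\<lambda>s. (f s - f t) /\<^sub>R (s - t)) \<longlongrightarrow> d) (at t within A) \<longleftrightarrow>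
        ((\<lambda>s. norm ((f s - f t) /\<^sub>R (s - t) - d)) \<longlongrightarrow> 0) (at t within A)"
    by (subst Lim_null) (simp only: tendsto_norm_zero_iff)
  also have "\<dots> \<longleftrightarrow> ((\<lambda>s. norm ((1 / norm (s - t)) *\<^sub>R (f s - (f t + (s - t) *\<^sub>R d)))) \<longlongrightarrow> 0) (at t within A)"
  proof (rule filterlim_cong[OF refl refl])
    show "\<forall>\<^sub>F s in at t within A. norm ((f s - f t) /\<^sub>R (s - t) - d) =
        norm ((1 / norm (s - t)) *\<^sub>R (f s - (f t + (s - t) *\<^sub>R d)))"
      unfolding eventually_at_filter
    proof (rule always_eventually, intro allI impI)
      fix s assume "s \<noteq> t"
      then have "(f s - f t) /\<^sub>R (s - t) - d = (1 / (s - t)) *\<^sub>R (f s - (f t + (s - t) *\<^sub>R d))"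
        by (simp add: scaleR_diff_right diff_diff_eq[symmetric] divide_inverse_commute)
      then show "norm ((f s - f t) /\<^sub>R (s - t) - d) =
          norm ((1 / norm (s - t)) *\<^sub>R (f s - (f t + (s - t) *\<^sub>R d)))"
        by simp
    qed
  qed
  also have "\<dots> \<longleftrightarrow> (f has_vector_derivative d) (at t within A)"
    unfolding has_vector_derivative_def has_derivative_within tendsto_norm_zero_iff
    by (simp add: bounded_linear_scaleR_left)
  finally show ?thesis by simp
qed

text \<open>Difference quotients vanish along zeros accumulating at \<open>t\<close>, hence so does
  their limit. It is applied to the difference of a lift and a translate of a lift.\<close>

lemma vector_derivative_frequently_zero:
  fixes f :: "real \<Rightarrow> 'a::real_normed_vector"
  assumes f: "(f has_vector_derivative d) (at t within A)"
    and freq: "\<exists>\<^sub>F s in at t within A. f s = 0"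
  shows "f t = 0" "d = 0"
proof -
  have "(f \<longlongrightarrow> f t) (at t within A)"
    using has_vector_derivative_continuous[OF f] by (simp add: continuous_within)
  then show 0: "f t = 0"
    using freq tendsto_imp_eventually_ne[of f "f t" "at t within A" 0] by (auto simp: frequently_def)
  have q: "((\<lambda>s. (f s - f t) /\<^sub>R (s - t)) \<longlongrightarrow> d) (at t within A)"
    using f by (simp add: has_vector_derivative_quotient)
  show "d = 0"
  proof (rule ccontr)
    assume "d \<noteq> 0"
    then have "\<forall>\<^sub>F s in at t within A. (f s - f t) /\<^sub>R (s - t) \<noteq> 0"
      by (rule tendsto_imp_eventually_ne[OF q])
    then have "\<forall>\<^sub>F s in at t within A. f s \<noteq> 0"
      by eventually_elim (auto simp: 0)
    with freq show False by (simp add: frequently_def)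
  qed
qed

lemma has_vector_derivative_matrix_mult:
  fixes g :: "complex^'n^'m"
  shows "(x has_vector_derivative w) F \<Longrightarrow> ((\<lambda>s. g *v x s) has_vector_derivative g *v w) F"
  by (rule bounded_linear.has_vector_derivative) simp_all

text \<open>Pigeonhole: \<open>G\<close> is finite, so among the elements \<open>k s\<close>
  relating the two curves one \<open>g\<close> recurs arbitrarily close to \<open>t\<close>. Then
  \<open>y s - g *v x s\<close> has zeros accumulating at \<open>t\<close>.\<close>

lemma orbit_match:
  fixes G :: "(complex^'n^'n) set"
  assumes G: "finite_matrix_group G" and xy: "\<And>s. orb G (x s) (y s)"
    and x: "(x has_vector_derivative w) (at t within A)"
    and y: "(y has_vector_derivative z) (at t within A)"
    and nb: "at t within A \<noteq> bot"
  obtains g where "g \<in> G" "y t = g *v x t" "z = g *v w"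
proof -
  obtain k where k: "\<And>s. k s \<in> G" "\<And>s. y s = k s *v x s"
    using xy unfolding orb_def by metis
  have "\<exists>g\<in>G. \<exists>\<^sub>F s in at t within A. k s = g"
  proof (rule ccontr)
    assume "\<not> ?thesis"
    then have "\<forall>\<^sub>F s in at t within A. \<forall>g\<in>G. k s \<noteq> g"
      using finite_matrix_group_finite[OF G] by (auto simp: frequently_def intro!: eventually_ball_finite)
    then have "\<forall>\<^sub>F s in at t within A. False"
      by eventually_elim (use k in auto)
    with nb show False by simp
  qed
  then obtain g where g: "g \<in> G" "\<exists>\<^sub>F s in at t within A. k s = g" by blast
  have "((\<lambda>s. y s - g *v x s) has_vector_derivative z - g *v w) (at t within A)"
    by (intro has_vector_derivative_diff y has_vector_derivative_matrix_mult x)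
  moreover have "\<exists>\<^sub>F s in at t within A. y s - g *v x s = 0"
    using g(2) by (rule frequently_elim1) (simp add: k(2))
  ultimately have "y t - g *v x t = 0" "z - g *v w = 0"
    by (rule vector_derivative_frequently_zero)+
  with g(1) that show ?thesis by simp
qed

text \<open>The curve \<open>x\<close> may depend on \<open>t\<close> and is regular at this one
  parameter alone. The orbit condition is imposed on all reals, which is harmless for a local notion
  and avoids bookkeeping of domains.\<close>

definition pointwise_lift ::
  "(complex^'n^'n) set \<Rightarrow> (real \<Rightarrow> complex^'n) \<Rightarrow> real \<Rightarrow> bool" where
  "pointwise_lift G x\<^sub>0 t \<longleftrightarrow>
     (\<exists>x w. (\<forall>s. orb G (x\<^sub>0 s) (x s)) \<and> (x has_vector_derivative w) (at t))"

text \<open>The derivative is taken within \<open>A\<close>, so that lifts on closed intervals have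
  one-sided derivatives at the endpoints, where they are glued.\<close>

definition diff_lift ::
  "(complex^'n^'n) set \<Rightarrow> (real \<Rightarrow> complex^'n) \<Rightarrow> real set \<Rightarrow> (real \<Rightarrow> complex^'n) \<Rightarrow> bool" where
  "diff_lift G x\<^sub>0 A x \<longleftrightarrow> (\<forall>s. orb G (x\<^sub>0 s) (x s)) \<and>
     (\<forall>t\<in>A. \<exists>w. (x has_vector_derivative w) (at t within A))"

lemma diff_lift_subset: "diff_lift G x\<^sub>0 A x \<Longrightarrow> B \<subseteq> A \<Longrightarrow> diff_lift G x\<^sub>0 B x"
  unfolding diff_lift_def by (meson has_vector_derivative_within_subset subsetD)

lemma diff_lift_open:
  "open A \<Longrightarrow> diff_lift G x\<^sub>0 A x \<longleftrightarrow>
     (\<forall>s. orb G (x\<^sub>0 s) (x s)) \<and> (\<forall>t\<in>A. \<exists>w. (x has_vector_derivative w) (at t))"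
  unfolding diff_lift_def by (metis at_within_open)

lemma diff_lift_translate:
  "finite_matrix_group G \<Longrightarrow> g \<in> G \<Longrightarrow> diff_lift G x\<^sub>0 A x \<Longrightarrow> diff_lift G x\<^sub>0 A (\<lambda>s. g *v x s)"
  unfolding diff_lift_def using orb_translate has_vector_derivative_matrix_mult by blast

text \<open>Both one-sided derivatives at \<open>b\<close> are compared with the two-sided
  derivative of the pointwise lift \<open>u\<close>. Without such a \<open>u\<close> the slopes on
  the two sides could be unrelated, as for the absolute value under the trivial group.\<close>

lemma diff_lift_glue:
  assumes G: "finite_matrix_group G" and b: "pointwise_lift G x\<^sub>0 b"
    and x: "diff_lift G x\<^sub>0 {a..b} x" and y: "diff_lift G x\<^sub>0 {b..c} y" and "a < b" "b < c"
  obtains g where "g \<in> G" "g *v y b = x b"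
    "diff_lift G x\<^sub>0 {a..c} (\<lambda>s. if s \<le> b then x s else g *v y s)"
proof -
  obtain u w where u: "\<And>s. orb G (x\<^sub>0 s) (u s)" "(u has_vector_derivative w) (at b)"
    using b by (auto simp: pointwise_lift_def)
  obtain x' where x': "\<And>t. t \<in> {a..b} \<Longrightarrow> (x has_vector_derivative x' t) (at t within {a..b})"
    using x unfolding diff_lift_def by metis
  obtain y' where y': "\<And>t. t \<in> {b..c} \<Longrightarrow> (y has_vector_derivative y' t) (at t within {b..c})"
    using y unfolding diff_lift_def by metis
  have xu: "orb G (u s) (x s)" and yu: "orb G (y s) (u s)" for s
    using x y u(1) orb_sym[OF G] orb_trans[OF G] unfolding diff_lift_def by blast+
  have "at b within {a..b} \<noteq> bot" "at b within {b..c} \<noteq> bot"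
    using \<open>a < b\<close> \<open>b < c\<close> by (simp_all add: trivial_limit_within)
  then obtain g h where g: "g \<in> G" "x b = g *v u b" "x' b = g *v w"
      and h: "h \<in> G" "u b = h *v y b" "w = h *v y' b"
    using orbit_match[OF G xu has_vector_derivative_at_within[OF u(2)] x'[of b]]
      orbit_match[OF G yu y'[of b] has_vector_derivative_at_within[OF u(2)]] \<open>a < b\<close> \<open>b < c\<close>
    by (metis atLeastAtMost_iff less_le order_refl)
  \<comment> \<open>At \<open>b\<close>, \<open>h\<close> carries \<open>y\<close> to
    \<open>u\<close> and \<open>g\<close> carries \<open>u\<close> to \<open>x\<close>, each
    together with the derivative.\<close>
  define k where "k = g ** h"
  have k: "k \<in> G" "k *v y b = x b" "k *v y' b = x' b"
    using g h finite_matrix_group_mult[OF G] by (simp_all add: k_def flip: matrix_vector_mul_assoc)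
  have "\<exists>w. ((\<lambda>s. if s \<le> b then x s else k *v y s) has_vector_derivative w) (at t within {a..c})"
    if t: "t \<in> {a..c}" for t
  proof -
    have "((\<lambda>s. if s \<in> {a..b} then x s else k *v y s) has_vector_derivative
            (if t \<in> {a..b} then x' t else k *v y' t)) (at t within {a..c})"
    \<comment> \<open>The second piece is half open to make the pieces disjoint. Their closures
      share just \<open>b\<close>, where both formulas must agree in value and derivative.\<close>
    proof (rule has_vector_derivative_If_within_closures[where T="{b<..c}"])
      have cl: "closure {b<..c} = {b..c}" "closure {a..b} \<inter> closure {b<..c} = {b}"
        and cl': "{a..b} \<union> {b} = {a..b}" "{b<..c} \<union> {b} = {b..c}"
        using \<open>a < b\<close> \<open>b < c\<close> by auto
      show "t \<in> {a..b} \<union> {b<..c}" "{a..c} = {a..b} \<union> {b<..c}"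
        using t \<open>a < b\<close> \<open>b < c\<close> by auto
      show "(x has_vector_derivative x' t) (at t within {a..b} \<union> closure {a..b} \<inter> closure {b<..c})"
        if "t \<in> {a..b} \<union> closure {a..b} \<inter> closure {b<..c}"
        using that x' unfolding cl(2) cl' by blast
      show "((\<lambda>s. k *v y s) has_vector_derivative k *v y' t) (at t within {b<..c} \<union> closure {a..b} \<inter> closure {b<..c})"
        if "t \<in> {b<..c} \<union> closure {a..b} \<inter> closure {b<..c}"
        using that y' has_vector_derivative_matrix_mult unfolding cl(2) cl' by blast
      assume "t \<in> closure {a..b}" "t \<in> closure {b<..c}"
      then have "t = b" using cl by blast
      then show "x t = k *v y t" "x' t = k *v y' t" using k by auto
    qed
    then show ?thesis
      by (intro exI, rule has_vector_derivative_transform[rotated 2]) (use t in auto)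
  qed
  moreover have "orb G (x\<^sub>0 s) (if s \<le> b then x s else k *v y s)" for s
    using x y orb_translate[OF G k(1)] by (auto simp: diff_lift_def)
  ultimately have "diff_lift G x\<^sub>0 {a..c} (\<lambda>s. if s \<le> b then x s else k *v y s)"
    by (simp add: diff_lift_def)
  with k that show ?thesis by blast
qed

section \<open>From local lifts to lifts on intervals\<close>

definition local_lift ::
  "(complex^'n^'n) set \<Rightarrow> (real \<Rightarrow> complex^'n) \<Rightarrow> real \<Rightarrow> bool" where
  "local_lift G x\<^sub>0 t \<longleftrightarrow> (\<exists>e>0. \<exists>x. diff_lift G x\<^sub>0 (ball t e) x)"

lemma local_lift_imp_pointwise: "local_lift G x\<^sub>0 t \<Longrightarrow> pointwise_lift G x\<^sub>0 t"
  unfolding local_lift_def pointwise_lift_def by (metis centre_in_ball diff_lift_open open_ball)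

text \<open>Bisection: short intervals around each parameter carry a lift, and lifts on adjacent
  intervals can be glued, because a local lift at the common endpoint is in particular a pointwise
  lift there.\<close>

lemma diff_lift_compact_interval:
  assumes G: "finite_matrix_group G" and loc: "\<And>t. t \<in> {a..b} \<Longrightarrow> local_lift G x\<^sub>0 t"
    and "a < b"
  obtains x where "diff_lift G x\<^sub>0 {a..b} x"
proof -
  \<comment> \<open>Vacuous for degenerate intervals, which the bisection principle also considers,
    and for intervals leaving \<open>{a..b}\<close>.\<close>
  define P where "P u v \<longleftrightarrow> (u < v \<and> {u..v} \<subseteq> {a..b} \<longrightarrow> (\<exists>x. diff_lift G x\<^sub>0 {u..v} x))" for u v
  have "P a b"
  proof (rule Bolzano)
    show "a \<le> b" using \<open>a < b\<close> by simp
  next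
    fix u v w assume uvw: "P u v" "P v w" "u \<le> v" "v \<le> w"
    show "P u w"
    proof (cases "u < v \<and> v < w \<and> {u..w} \<subseteq> {a..b}")
      case True
      then have "{u..v} \<subseteq> {a..b}" "{v..w} \<subseteq> {a..b}" "v \<in> {a..b}" by auto
      with True uvw obtain x y where "diff_lift G x\<^sub>0 {u..v} x" "diff_lift G x\<^sub>0 {v..w} y"
        unfolding P_def by blast
      with True show ?thesis
        using diff_lift_glue[OF G local_lift_imp_pointwise[OF loc[OF \<open>v \<in> {a..b}\<close>]]]
        unfolding P_def by blast
    next
      case False
      with uvw show ?thesis unfolding P_def by (metis less_le)
    qed
  next
    fix t assume "a \<le> t" "t \<le> b"
    then obtain e x where e: "e > 0" "diff_lift G x\<^sub>0 (ball t e) x"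
      using loc[of t] by (auto simp: local_lift_def)
    have "{u..v} \<subseteq> ball t e" if "u \<le> t" "t \<le> v" "v - u < e" for u v
      using that by (auto simp: dist_real_def)
    with e have "\<forall>u v. u \<le> t \<and> t \<le> v \<and> v - u < e \<longrightarrow> P u v"
      unfolding P_def using diff_lift_subset by blast
    with e(1) show "\<exists>d>0. \<forall>u v. u \<le> t \<and> t \<le> v \<and> v - u < d \<longrightarrow> P u v" by blast
  qed
  with \<open>a < b\<close> that show ?thesis by (auto simp: P_def)
qed

lemma diff_lift_extend_right:
  assumes G: "finite_matrix_group G" and loc: "\<And>t. t \<in> {a..c} \<Longrightarrow> local_lift G x\<^sub>0 t"
    and "a < b" "b \<le> c" and x: "diff_lift G x\<^sub>0 {a..b} x"
  obtains y where "diff_lift G x\<^sub>0 {a..c} y" "\<And>s. s \<in> {a..b} \<Longrightarrow> y s = x s"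
proof (cases "b = c")
  case True
  with x that show ?thesis by blast
next
  case False
  then have "b < c" using \<open>b \<le> c\<close> by simp
  obtain y where y: "diff_lift G x\<^sub>0 {b..c} y"
    using diff_lift_compact_interval[OF G loc, of b c] \<open>a < b\<close> \<open>b < c\<close> by auto
  have "pointwise_lift G x\<^sub>0 b"
    using loc[of b] local_lift_imp_pointwise \<open>a < b\<close> \<open>b < c\<close> by auto
  from diff_lift_glue[OF G this x y \<open>a < b\<close> \<open>b < c\<close>]
  obtain g where "diff_lift G x\<^sub>0 {a..c} (\<lambda>s. if s \<le> b then x s else g *v y s)" by blast
  then show ?thesis by (rule that) auto
qed

text \<open>Gluing adjusts the right-hand piece by \<open>g\<close>, but here that piece has to stay
  as it is. Translating the whole result by the inverse of \<open>g\<close> restores it.\<close>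

lemma diff_lift_extend_left:
  assumes G: "finite_matrix_group G" and loc: "\<And>t. t \<in> {a..c} \<Longrightarrow> local_lift G x\<^sub>0 t"
    and "a \<le> b" "b < c" and y: "diff_lift G x\<^sub>0 {b..c} y"
  obtains x where "diff_lift G x\<^sub>0 {a..c} x" "\<And>s. s \<in> {b..c} \<Longrightarrow> x s = y s"
proof (cases "a = b")
  case True
  with y that show ?thesis by blast
next
  case False
  then have "a < b" using \<open>a \<le> b\<close> by simp
  obtain x where x: "diff_lift G x\<^sub>0 {a..b} x"
    using diff_lift_compact_interval[OF G loc, of a b] \<open>a < b\<close> \<open>b < c\<close> by auto
  have "pointwise_lift G x\<^sub>0 b"
    using loc[of b] local_lift_imp_pointwise \<open>a < b\<close> \<open>b < c\<close> by auto
  from diff_lift_glue[OF G this x y \<open>a < b\<close> \<open>b < c\<close>]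
  obtain g where g: "g \<in> G" "g *v y b = x b"
      and z: "diff_lift G x\<^sub>0 {a..c} (\<lambda>s. if s \<le> b then x s else g *v y s)" by blast
  obtain h where h: "h \<in> G" "\<And>u. h *v (g *v u) = u"
    by (rule finite_matrix_group_inverse[OF G g(1)]) metis
  from diff_lift_translate[OF G h(1) z] show ?thesis
    by (rule that) (use h(2) in \<open>auto simp flip: g(2)\<close>)
qed

text \<open>\<open>J\<close> is exhausted by compact intervals, and each lift extends the previous
  one without changing it, so that the lifts have a union.\<close>

lemma diff_lift_open_interval:
  assumes G: "finite_matrix_group G" and J: "open J" "is_interval J"
    and loc: "\<And>t. t \<in> J \<Longrightarrow> local_lift G x\<^sub>0 t"
  obtains x where "diff_lift G x\<^sub>0 J x"
proof (cases "J = {}")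
  case True
  have "diff_lift G x\<^sub>0 {} x\<^sub>0" by (simp add: diff_lift_def orb_refl[OF G])
  with True that show ?thesis by blast
next
  case False
  then obtain t\<^sub>0 where t0: "t\<^sub>0 \<in> J" by blast
  have wide: "\<exists>p\<in>J. \<exists>q\<in>J. p < t \<and> t < q" if "t \<in> J" for t
  proof -
    obtain e where e: "e > 0" "cball t e \<subseteq> J"
      using J(1) \<open>t \<in> J\<close> open_contains_cball_eq by meson
    have "t - e \<in> cball t e" "t + e \<in> cball t e" using e(1) by (auto simp: dist_real_def)
    with e show ?thesis by (intro bexI[of _ "t-e"] bexI[of _ "t+e"]) auto
  qed
  have sub: "{p..q} \<subseteq> J" if "p \<in> J" "q \<in> J" for p q
    using mem_is_interval_1_I[OF J(2) that] by auto
  \<comment> \<open>Enumerating the rationals of \<open>J\<close> gives an exhaustion that treats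
    bounded and unbounded intervals alike; \<open>t\<^sub>0\<close> is added to have a nonempty set
    at hand. Step \<open>k\<close> enlarges the interval to contain \<open>e k\<close>.\<close>
  define e where "e = from_nat_into (insert t\<^sub>0 (J \<inter> \<rat>))"
  have range_e: "range e = insert t\<^sub>0 (J \<inter> \<rat>)"
    unfolding e_def by (rule range_from_nat_into) (simp_all add: countable_rat)
  have eJ: "e k \<in> J" for k using range_e t0 by (metis IntE insertE rangeI)
  have cofinal: "\<exists>i j. e i < t \<and> t < e j" if "t \<in> J" for t
  proof -
    obtain p q where pq: "p \<in> J" "q \<in> J" "p < t" "t < q" using wide[OF \<open>t \<in> J\<close>] by blast
    obtain p' q' where "p' \<in> \<rat>" "p < p'" "p' < t" "q' \<in> \<rat>" "t < q'" "q' < q"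
      using Rats_dense_in_real[OF pq(3)] Rats_dense_in_real[OF pq(4)] by blast
    moreover from this have "p' \<in> J" "q' \<in> J"
      using sub[OF pq(1) pq(2)] pq by auto
    ultimately show ?thesis using range_e by (metis IntI imageE insertI2)
  qed
  define P where "P = (\<lambda>(k::nat) (a, b, x). a < b \<and> a \<in> J \<and> b \<in> J \<and> diff_lift G x\<^sub>0 {a..b} x)"
  define Q where "Q = (\<lambda>k (a, b, x) (a', b', x'). a' \<le> a \<and> b \<le> b' \<and> a' \<le> e k \<and> e k \<le> b' \<and>
    (\<forall>s\<in>{a..b}. x' s = (x s :: complex^'a)))"
  have "\<exists>f. \<forall>k. P k (f k) \<and> Q k (f k) (f (Suc k))"
  proof (rule dependent_nat_choice)
    obtain p where p: "p \<in> J" "p < t\<^sub>0" using wide[OF t0] by blast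
    obtain x where "diff_lift G x\<^sub>0 {p..t\<^sub>0} x"
      using diff_lift_compact_interval[OF G loc p(2)] sub[OF p(1) t0] by blast
    with p t0 show "\<exists>x. P 0 x" by (auto simp: P_def)
  next
    fix y k assume Py: "P k y"
    obtain a b x where y: "y = (a, b, x)" by (cases y)
    have abx: "a < b" "a \<in> J" "b \<in> J" "diff_lift G x\<^sub>0 {a..b} x" using Py by (auto simp: P_def y)
    define a' b' where "a' = min a (e k)" and "b' = max b (e k)"
    have a'b': "a' \<in> J" "b' \<in> J" "a' \<le> a" "b \<le> b'" "a' \<le> e k" "e k \<le> b'"
      using abx eJ by (auto simp: a'_def b'_def min_def max_def)
    obtain x1 where x1: "diff_lift G x\<^sub>0 {a..b'} x1" "\<And>s. s \<in> {a..b} \<Longrightarrow> x1 s = x s"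
      using diff_lift_extend_right[OF G loc abx(1) a'b'(4) abx(4)] sub[OF abx(2) a'b'(2)] by blast
    have "a < b'" using abx a'b' by simp
    obtain x2 where x2: "diff_lift G x\<^sub>0 {a'..b'} x2" "\<And>s. s \<in> {a..b'} \<Longrightarrow> x2 s = x1 s"
      using diff_lift_extend_left[OF G loc a'b'(3) \<open>a < b'\<close> x1(1)] sub[OF a'b'(1) a'b'(2)] by blast
    have "P (Suc k) (a', b', x2) \<and> Q k y (a', b', x2)"
      using a'b' \<open>a < b'\<close> x1 x2 by (auto simp: P_def Q_def y)
    then show "\<exists>z. P (Suc k) z \<and> Q k y z" by blast
  qed
  then obtain f where f: "\<And>k. P k (f k)" "\<And>k. Q k (f k) (f (Suc k))" by blast
  define a b X where "a = (\<lambda>k. fst (f k))" and "b = (\<lambda>k. fst (snd (f k)))" and "X = (\<lambda>k. snd (snd (f k)))"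
  have fk: "f k = (a k, b k, X k)" for k by (simp add: a_def b_def X_def)
  have L: "diff_lift G x\<^sub>0 {a k..b k} (X k)" for k using f(1)[of k] by (simp add: P_def fk)
  have steps: "a (Suc k) \<le> a k" "b k \<le> b (Suc k)" "a (Suc k) \<le> e k" "e k \<le> b (Suc k)"
    "\<And>s. s \<in> {a k..b k} \<Longrightarrow> X (Suc k) s = X k s" for k
    using f(2)[of k] by (auto simp: Q_def fk)
  have mono: "a l \<le> a k \<and> b k \<le> b l \<and> (\<forall>s\<in>{a k..b k}. X l s = X k s)" if "k \<le> l" for k l
    using that
  proof (induction l rule: dec_induct)
    case base
    then show ?case by simp
  next
    case (step l)
    have "X (Suc l) s = X k s" if "s \<in> {a k..b k}" for s
      using that step.IH steps(5)[of s l] by simp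
    with step.IH steps(1,2)[of l] show ?case by auto
  qed
  have agree: "X k s = X l s" if "s \<in> {a k..b k}" "s \<in> {a l..b l}" for k l s
    using mono[of k l] mono[of l k] that by (metis nat_le_linear)
  have cover: "\<exists>k. t \<in> {a k<..<b k}" if t: "t \<in> J" for t
  proof -
    obtain i j where ij: "e i < t" "t < e j" using cofinal[OF t] by blast
    define k where "k = Suc (max i j)"
    have "a k \<le> a (Suc i)" "b (Suc j) \<le> b k"
      using mono[of "Suc i" k] mono[of "Suc j" k] by (auto simp: k_def)
    with steps(3)[of i] steps(4)[of j] ij have "t \<in> {a k<..<b k}" by auto
    then show ?thesis by blast
  qed
  \<comment> \<open>Outside all the intervals the chosen \<open>k\<close> is arbitrary, but
    \<open>X k\<close> is a lift there too.\<close>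
  define x where "x s = X (SOME k. s \<in> {a k..b k}) s" for s
  have x_eq: "x s = X k s" if "s \<in> {a k..b k}" for s k
    unfolding x_def by (rule agree[OF someI[of "\<lambda>k. s \<in> {a k..b k}", OF that] that])
  have "diff_lift G x\<^sub>0 J x"
    unfolding diff_lift_open[OF J(1)]
  proof (intro conjI allI ballI)
    show "orb G (x\<^sub>0 s) (x s)" for s using L unfolding x_def diff_lift_def by blast
    fix t assume "t \<in> J"
    then obtain k where k: "t \<in> {a k<..<b k}" using cover by blast
    have "diff_lift G x\<^sub>0 {a k<..<b k} (X k)" using L by (rule diff_lift_subset) auto
    then obtain w where "(X k has_vector_derivative w) (at t)"
      using k unfolding diff_lift_open[OF open_greaterThanLessThan] by blast
    then have "(x has_vector_derivative w) (at t)"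
      by (rule has_vector_derivative_transform_within_open[OF _ open_greaterThanLessThan k])
        (rule x_eq[symmetric], auto)
    then show "\<exists>w. (x has_vector_derivative w) (at t)" by blast
  qed
  with that show ?thesis by blast
qed

text \<open>The difference quotient of \<open>x\<close> follows the finite orbit of the derivative at \<open>t\<close> of a
  pointwise lift; being continuous off \<open>t\<close>, it converges to a single point of that orbit.\<close>
lemma one_sided_derivative_at_fixed_point:
  assumes G: "finite_matrix_group G" and t: "pointwise_lift G x\<^sub>0 t"
    and fix0: "\<And>g. g \<in> G \<Longrightarrow> g *v x\<^sub>0 t = x\<^sub>0 t"
    and x: "\<And>s. orb G (x\<^sub>0 s) (x s)" and A: "convex A" "t \<notin> A" and cont: "continuous_on A x"
  obtains w where "(x has_vector_derivative w) (at t within A)"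
proof -
  obtain u w where u: "\<And>s. orb G (x\<^sub>0 s) (u s)" "(u has_vector_derivative w) (at t)"
    using t by (auto simp: pointwise_lift_def)
  have ut: "u t = x\<^sub>0 t" "x t = x\<^sub>0 t" using u(1)[of t] x[of t] fix0 by (auto simp: orb_def)
  have "orb G (u s) (x s)" for s using u(1) x orb_sym[OF G] orb_trans[OF G] by blast
  then obtain k where k: "\<And>s. k s \<in> G" "\<And>s. x s = k s *v u s" unfolding orb_def by metis
  define q p where "q s = (x s - x t) /\<^sub>R (s - t)" and "p s = (u s - u t) /\<^sub>R (s - t)" for s
  \<comment> \<open>Both curves take the fixed value \<open>x\<^sub>0 t\<close> at \<open>t\<close>,
    so \<open>k s\<close> relates the difference quotients as it relates the curves.\<close>
  have qp: "q s = k s *v p s" for s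
    unfolding q_def p_def
    by (metis fix0 k ut matrix_vector_mult_diff_distrib matrix_vector_mult_scaleR_complex)
  have p: "(p \<longlongrightarrow> w) (at t)" using u(2) unfolding p_def has_vector_derivative_quotient .
  obtain M where M: "M > 0" "\<And>g x. g \<in> G \<Longrightarrow> norm (g *v x) \<le> M * norm x"
    using finite_matrix_set_bound[OF finite_matrix_group_finite[OF G]] by blast
  define f where "f s = k s *v w" for s
  have near: "norm (q s - f s) \<le> M * norm (p s - w)" for s
    unfolding qp f_def matrix_vector_mult_diff_distrib[symmetric] using M(2) k(1) by blast
  define F where "F = (\<lambda>g. g *v w) ` G"
  have F: "finite F" "\<And>s. f s \<in> F" using finite_matrix_group_finite[OF G] k(1) by (auto simp: F_def f_def)
  obtain d where d: "d > 0" "\<And>y z. y \<in> F \<Longrightarrow> z \<in> F \<Longrightarrow> dist y z < d \<Longrightarrow> y = z"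
  proof -
    obtain d where "d > 0" "\<forall>y\<in>F. \<forall>z\<in>F. y \<noteq> z \<longrightarrow> d \<le> dist y z"
    proof -
      have "\<forall>y\<in>F. \<exists>d>0. \<forall>z\<in>F. z \<noteq> y \<longrightarrow> d \<le> dist y z"
        using finite_set_avoid[OF F(1)] by blast
      then obtain \<delta> where \<delta>: "\<And>y. y \<in> F \<Longrightarrow> \<delta> y > 0 \<and> (\<forall>z\<in>F. z \<noteq> y \<longrightarrow> \<delta> y \<le> dist y z)" by metis
      have "F \<noteq> {}" using F(2) by blast
      then have "Min (\<delta> ` F) > 0" using F(1) \<delta> by (subst Min_gr_iff) auto
      moreover have "\<forall>y\<in>F. \<forall>z\<in>F. y \<noteq> z \<longrightarrow> Min (\<delta> ` F) \<le> dist y z"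
        using F(1) \<delta> by (metis Min_le finite_imageI imageI order_trans)
      ultimately show ?thesis using that by blast
    qed
    then show ?thesis using that[of d] by (meson linorder_not_le)
  qed
  \<comment> \<open>The factor \<open>M\<close> turns this into distance below \<open>d / 3\<close>
    between \<open>q s\<close> and \<open>f s\<close>. Three such distances keep \<open>f s\<close>
    and \<open>f s'\<close> closer than \<open>d\<close>, the gap of the finite set
    \<open>F\<close>, hence equal.\<close>
  have "\<forall>\<^sub>F s in at t. dist (p s) w < d / (3 * M)"
    using p by (rule tendstoD) (use d(1) M(1) in simp)
  then obtain \<eta> where \<eta>: "\<eta> > 0" "\<And>s. s \<noteq> t \<Longrightarrow> dist s t < \<eta> \<Longrightarrow> dist (p s) w < d / (3 * M)"
    by (auto simp: eventually_at)
  define B where "B = A \<inter> ball t \<eta>"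
  have conB: "connected B" unfolding B_def by (intro convex_connected convex_Int A convex_ball)
  have close: "dist (q s) (f s) < d / 3" if "s \<in> B" for s
  proof -
    have "dist (p s) w < d / (3 * M)"
      using that A(2) by (intro \<eta>(2)) (auto simp: B_def dist_commute)
    then have "M * norm (p s - w) < d / 3" using M(1) by (simp add: dist_norm field_simps)
    with near[of s] show ?thesis by (simp add: dist_norm)
  qed
  have contq: "continuous_on B q"
    unfolding q_def using A(2)
    by (intro continuous_intros continuous_on_subset[OF cont]) (auto simp: B_def)
  have "\<forall>\<^sub>F s' in at s within B. f s = f s'" if s: "s \<in> B" for s
  proof -
    have "(q \<longlongrightarrow> q s) (at s within B)" using contq s by (simp add: continuous_on)
    then have "\<forall>\<^sub>F s' in at s within B. dist (q s') (q s) < d / 3"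
      by (rule tendstoD) (use d(1) in simp)
    moreover have "\<forall>\<^sub>F s' in at s within B. s' \<in> B"
      by (simp add: eventually_at_filter)
    ultimately show ?thesis
    proof eventually_elim
      case (elim s')
      have "dist (f s') (f s) \<le> dist (q s') (f s') + dist (q s') (q s) + dist (q s) (f s)"
        using dist_triangle[of "f s'" "f s" "q s'"] dist_triangle[of "q s'" "f s" "q s"]
        by (simp add: dist_commute)
      then have "dist (f s) (f s') < d"
        using close[OF elim(2)] close[OF s] elim(1) by (simp add: dist_commute)
      then show ?case by (rule d(2)[OF F(2) F(2)])
    qed
  qed
  then have "f s = f s'" if "s \<in> B" "s' \<in> B" for s s'
    using connected_local_const[OF conB that] by blast
  then obtain z where z: "\<And>s. s \<in> B \<Longrightarrow> f s = z" by blast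
  have evB: "\<forall>\<^sub>F s in at t within A. s \<in> B"
    unfolding eventually_at using \<eta>(1) by (auto simp: B_def dist_commute intro!: exI[of _ \<eta>])
  have "((\<lambda>s. M * norm (p s - w)) \<longlongrightarrow> 0) (at t within A)"
    using tendsto_within_subset[OF p, of A] by (auto intro!: tendsto_mult_right_zero tendsto_norm_zero simp: LIM_zero_iff)
  then have "((\<lambda>s. q s - z) \<longlongrightarrow> 0) (at t within A)"
  proof (rule Lim_null_comparison[rotated])
    show "\<forall>\<^sub>F s in at t within A. norm (q s - z) \<le> M * norm (p s - w)"
      using evB by eventually_elim (use near z in metis)
  qed
  then have "(q \<longlongrightarrow> z) (at t within A)" by (simp add: LIM_zero_iff)
  then have "(x has_vector_derivative z) (at t within A)"
    unfolding has_vector_derivative_quotient q_def .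
  with that show ?thesis .
qed

section \<open>From pointwise lifts to differentiable lifts\<close>

text \<open>On each side of \<open>t\<close> the local lifts combine to a lift on an open interval
  ending at \<open>t\<close>. It has a one-sided derivative at \<open>t\<close> because
  \<open>x\<^sub>0 t\<close> is fixed, and the two sides are then glued through the pointwise
  lift.\<close>

lemma local_lift_isolated_fixed_point:
  assumes G: "finite_matrix_group G" and t: "pointwise_lift G x\<^sub>0 t"
    and fix0: "\<And>g. g \<in> G \<Longrightarrow> g *v x\<^sub>0 t = x\<^sub>0 t" and "d > 0"
    and loc: "\<And>s. s \<in> ball t d \<Longrightarrow> s \<noteq> t \<Longrightarrow> local_lift G x\<^sub>0 s"
  shows "local_lift G x\<^sub>0 t"
proof -
  have side: "\<exists>x. diff_lift G x\<^sub>0 (insert t A) x"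
    if A: "open A" "convex A" "t \<notin> A" "A \<subseteq> ball t d" for A
  proof -
    obtain x where x: "diff_lift G x\<^sub>0 A x"
    proof (rule diff_lift_open_interval[OF G A(1)])
      show "is_interval A" using A(2) by (simp add: is_interval_convex_1)
      show "local_lift G x\<^sub>0 s" if "s \<in> A" for s using A(3,4) that by (intro loc) auto
    qed
    have "continuous_on A x"
      using x unfolding diff_lift_def continuous_on_eq_continuous_within
      using has_vector_derivative_continuous by blast
    then obtain w where w: "(x has_vector_derivative w) (at t within A)"
      using one_sided_derivative_at_fixed_point[OF G t fix0 _ A(2,3)] x unfolding diff_lift_def by blast
    have "\<exists>w. (x has_vector_derivative w) (at s within insert t A)" if s: "s \<in> insert t A" for s
    proof (cases "s = t")
      case True
      \<comment> \<open>The filter at \<open>t\<close> ignores \<open>t\<close> itself, so the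
        one-sided derivative survives adding \<open>t\<close> to the set.\<close>
      with w show ?thesis
        unfolding has_vector_derivative_quotient by (auto simp: at_within_def)
    next
      case False
      then obtain w where "(x has_vector_derivative w) (at s)"
        using s x by (auto simp: diff_lift_open[OF A(1)])
      then show ?thesis using has_vector_derivative_at_within by blast
    qed
    with x show ?thesis unfolding diff_lift_def by blast
  qed
  obtain x where x: "diff_lift G x\<^sub>0 (insert t {t-d<..<t}) x"
    using side[of "{t-d<..<t}"] by (auto simp: dist_real_def subset_iff)
  obtain y where y: "diff_lift G x\<^sub>0 (insert t {t<..<t+d}) y"
    using side[of "{t<..<t+d}"] by (auto simp: dist_real_def subset_iff)
  have x': "diff_lift G x\<^sub>0 {t-d/2..t} x"
    by (rule diff_lift_subset[OF x]) (use \<open>d > 0\<close> in auto)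
  have y': "diff_lift G x\<^sub>0 {t..t+d/2} y"
    by (rule diff_lift_subset[OF y]) (use \<open>d > 0\<close> in auto)
  obtain z where z: "diff_lift G x\<^sub>0 {t-d/2..t+d/2} z"
    using diff_lift_glue[OF G t x' y'] \<open>d > 0\<close> by auto
  have "diff_lift G x\<^sub>0 (ball t (d/2)) z"
    by (rule diff_lift_subset[OF z]) (auto simp: dist_real_def abs_if split: if_splits)
  then show ?thesis unfolding local_lift_def using \<open>d > 0\<close> by (metis half_gt_zero)
qed

text \<open>Near a point \<open>t\<close> a pointwise lift stays in a slice at its value \<open>v\<close>, where orbits of
  the group are orbits of the isotropy group of \<open>v\<close>.\<close>
lemma pointwise_lift_slice:
  fixes G :: "(complex^'n^'n) set"
  assumes G: "finite_matrix_group G" and I: "open I" "t \<in> I"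
    and pw: "\<And>s. s \<in> I \<Longrightarrow> pointwise_lift G x\<^sub>0 s"
  obtains u e where "e > 0" "\<And>s. orb G (x\<^sub>0 s) (u s)"
    "\<And>s. s \<in> ball t e \<Longrightarrow> pointwise_lift (stab G (u t)) u s"
proof -
  obtain u w where u: "\<And>s. orb G (x\<^sub>0 s) (u s)" "(u has_vector_derivative w) (at t)"
    using pw[OF I(2)] by (auto simp: pointwise_lift_def)
  define H where "H = stab G (u t)"
  have H: "finite_matrix_group H" unfolding H_def by (rule finite_matrix_group_stab[OF G])
  obtain r where r: "r > 0"
    "\<And>g x. g \<in> G \<Longrightarrow> norm (x - u t) < r \<Longrightarrow> norm (g *v x - u t) < r \<Longrightarrow> g *v u t = u t"
    using slice_radius[OF finite_matrix_group_finite[OF G]] by blast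
  have "isCont u t" using has_vector_derivative_continuous[OF u(2)] by simp
  then obtain e1 where e1: "e1 > 0" "\<And>s. dist s t < e1 \<Longrightarrow> dist (u s) (u t) < r"
    using r(1) unfolding continuous_at_eps_delta by blast
  obtain e2 where e2: "e2 > 0" "ball t e2 \<subseteq> I" using I open_contains_ball_eq by meson
  define e where "e = min e1 e2"
  have e: "e > 0" "ball t e \<subseteq> I" "\<And>s. s \<in> ball t e \<Longrightarrow> norm (u s - u t) < r"
    using e1 e2 by (auto simp: e_def dist_norm subset_iff norm_minus_commute)
  have "pointwise_lift H u s" if s: "s \<in> ball t e" for s
  proof -
    obtain y w where y: "\<And>s. orb G (x\<^sub>0 s) (y s)" "(y has_vector_derivative w) (at s)"
      using pw[of s] e(2) s unfolding pointwise_lift_def by blast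
    have "orb G (y s) (u s)" using u(1) y(1) orb_sym[OF G] orb_trans[OF G] by blast
    \<comment> \<open>Translating by \<open>h\<close> makes the lift belonging to \<open>s\<close>
      pass through \<open>u s\<close>, hence through the slice.\<close>
    then obtain h where h: "h \<in> G" "u s = h *v y s" by (auto simp: orb_def)
    define y' where "y' p = h *v y p" for p
    have y': "(y' has_vector_derivative h *v w) (at s)" "y' s = u s"
      unfolding y'_def using y(2) h(2) by (auto intro: has_vector_derivative_matrix_mult)
    have "orb G (u p) (y' p)" for p
      unfolding y'_def using u(1) y(1) orb_sym[OF G] orb_trans[OF G] orb_translate[OF G h(1)] by blast
    then obtain k where k: "\<And>p. k p \<in> G" "\<And>p. y' p = k p *v u p" unfolding orb_def by metis
    \<comment> \<open>Falling back on \<open>u\<close> where \<open>k p\<close> is not in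
      \<open>H\<close> makes \<open>y''\<close> a lift for \<open>H\<close> everywhere. Near
      \<open>s\<close> both \<open>u p\<close> and \<open>y' p\<close> are within \<open>r\<close>
      of \<open>u t\<close>, so there \<open>k p\<close> is in \<open>H\<close> and
      \<open>y''\<close> is \<open>y'\<close>.\<close>
    define y'' where "y'' p = (if k p \<in> H then y' p else u p)" for p
    have lift: "orb H (u p) (y'' p)" for p
      using k(2) orb_refl[OF H] by (auto simp: y''_def orb_def)
    have "isCont y' s" using has_vector_derivative_continuous[OF y'(1)] by simp
    then have "(y' \<longlongrightarrow> u s) (at s)" using y'(2) by (simp add: continuous_at)
    then have "\<forall>\<^sub>F p in at s. y' p \<in> ball (u t) r"
      by (rule topological_tendstoD) (use e(3)[OF s] in \<open>auto simp: dist_norm norm_minus_commute\<close>)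
    moreover have "\<forall>\<^sub>F p in at s. p \<in> ball t e"
      by (rule eventually_at_in_open') (use s in auto)
    ultimately have "\<forall>\<^sub>F p in at s. y' p = y'' p"
    proof eventually_elim
      case (elim p)
      then have "k p *v u t = u t"
        using r(2)[OF k(1), of "u p" p] e(3)[of p] k(2)[of p] by (auto simp: dist_norm norm_minus_commute)
      then show ?case using k(1) by (simp add: y''_def H_def stab_def)
    qed
    then have "\<forall>\<^sub>F p in at s. (y' p - y' s) /\<^sub>R (p - s) = (y'' p - y'' s) /\<^sub>R (p - s)"
      by eventually_elim (simp add: y''_def y'(2))
    with y'(1) have "(y'' has_vector_derivative h *v w) (at s)"
      unfolding has_vector_derivative_quotient by (rule Lim_transform_eventually)
    with lift show ?thesis by (auto simp: pointwise_lift_def)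
  qed
  with that e(1) u(1) show ?thesis unfolding H_def by blast
qed

text \<open>The induction generalizes over the interval and the reference choice: passing to an
  isotropy group replaces \<open>I\<close> by a ball and \<open>x\<^sub>0\<close> by a pointwise
  lift \<open>u\<close>.\<close>

theorem pointwise_lift_imp_diff_lift:
  fixes G :: "(complex^'n^'n) set"
  assumes "finite_matrix_group G" "open I" "\<And>t. t \<in> I \<Longrightarrow> pointwise_lift G x\<^sub>0 t"
  shows "\<exists>x. diff_lift G x\<^sub>0 I x"
  using assms
proof (induction "card G" arbitrary: G I x\<^sub>0 rule: less_induct)
  case less
  note G = less.prems(1) and I = less.prems(2) and pw = less.prems(3)
  define E where "E = {t \<in> I. \<forall>g\<in>G. g *v x\<^sub>0 t = x\<^sub>0 t}"
  have loc1: "local_lift G x\<^sub>0 t" if t: "t \<in> I" "t \<notin> E" for t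
  proof -
    obtain u e where u: "e > 0" "\<And>s. orb G (x\<^sub>0 s) (u s)"
        "\<And>s. s \<in> ball t e \<Longrightarrow> pointwise_lift (stab G (u t)) u s"
      by (rule pointwise_lift_slice[OF G I t(1) pw]) (assumption, rule that)
    \<comment> \<open>If all of \<open>G\<close> fixed \<open>u t\<close>, its orbit would be a
      single point, so \<open>u t\<close> would equal \<open>x\<^sub>0 t\<close> and
      \<open>t\<close> would lie in \<open>E\<close>.\<close>
    have "stab G (u t) \<noteq> G"
    proof
      assume *: "stab G (u t) = G"
      have "orb G (u t) (x\<^sub>0 t)" using orb_sym[OF G u(2)] .
      then have "x\<^sub>0 t = u t" using * by (auto simp: orb_def stab_def)
      with * t show False by (auto simp: E_def stab_def)
    qed
    then have "card (stab G (u t)) < card G"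
      using stab_subset finite_matrix_group_finite[OF G] by (metis psubsetI psubset_card_mono)
    from less.hyps[OF this finite_matrix_group_stab[OF G] open_ball u(3)]
    obtain x where x: "diff_lift (stab G (u t)) u (ball t e) x" by blast
    have "diff_lift G x\<^sub>0 (ball t e) x"
      unfolding diff_lift_def
    proof (intro conjI allI)
      show "orb G (x\<^sub>0 s) (x s)" for s
        using u(2) x orb_mono[OF stab_subset] orb_trans[OF G] unfolding diff_lift_def by blast
    qed (use x in \<open>auto simp: diff_lift_def\<close>)
    with u(1) show ?thesis by (auto simp: local_lift_def)
  qed
  have loc: "local_lift G x\<^sub>0 t" if t: "t \<in> I" "\<not> t islimpt E" for t
  proof (cases "t \<in> E")
    case True
    obtain d1 where d1: "d1 > 0" "\<And>s. s \<in> E \<Longrightarrow> s \<noteq> t \<Longrightarrow> dist s t \<ge> d1"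
      using t(2) unfolding islimpt_approachable by (meson linorder_not_less)
    obtain d2 where d2: "d2 > 0" "ball t d2 \<subseteq> I" using I t(1) open_contains_ball_eq by meson
    show ?thesis
    proof (rule local_lift_isolated_fixed_point[OF G pw[OF t(1)]])
      show "min d1 d2 > 0" using d1 d2 by simp
      show "g *v x\<^sub>0 t = x\<^sub>0 t" if "g \<in> G" for g using True that by (simp add: E_def)
      fix s assume "s \<in> ball t (min d1 d2)" "s \<noteq> t"
      then show "local_lift G x\<^sub>0 s"
        using d1(2)[of s] d2(2) by (intro loc1) (auto simp: dist_commute)
    qed
  qed (use loc1 t in blast)
  \<comment> \<open>The accumulation points of \<open>E\<close> form a closed set, so
    \<open>U\<close> is open and its components are open intervals. Lifts on different components
    are chosen independently of each other.\<close>
  define U where "U = I - {t. t islimpt E}"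
  have U: "open U" unfolding U_def by (intro open_Diff I closed_limpts)
  define C where "C s = connected_component_set U s" for s
  have C: "open (C s)" "is_interval (C s)" "C s \<subseteq> U" for s
    unfolding C_def using U
    by (auto simp: open_connected_component is_interval_connected_1 connected_component_subset)
  have exC: "\<exists>x. diff_lift G x\<^sub>0 (C s) x" for s
  proof (rule diff_lift_open_interval[OF G C(1,2)])
    show "local_lift G x\<^sub>0 p" if "p \<in> C s" for p
      using that C(3) by (intro loc) (auto simp: U_def)
  qed blast
  \<comment> \<open>Indexed by the component as a set, so that all points of a component use the
    same lift.\<close>
  define X where "X A = (SOME x. diff_lift G x\<^sub>0 A x)" for A
  have X: "diff_lift G x\<^sub>0 (C s) (X (C s))" for s
    unfolding X_def using exC by (rule someI_ex)
  define x where "x s = (if s \<in> U then X (C s) s else x\<^sub>0 s)" for s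
  have lift: "orb G (x\<^sub>0 s) (x s)" for s
    using X orb_refl[OF G] unfolding x_def diff_lift_def by auto
  have "\<exists>w. (x has_vector_derivative w) (at t)" if t: "t \<in> I" for t
  proof (cases "t \<in> U")
    case True
    then have tC: "t \<in> C t" by (simp add: C_def)
    have "x s = X (C t) s" if "s \<in> C t" for s
    proof -
      have "C s = C t" "s \<in> U" using that C(3) connected_component_eq unfolding C_def by blast+
      then show ?thesis by (simp add: x_def)
    qed
    moreover obtain w where "(X (C t) has_vector_derivative w) (at t)"
      using X[of t] tC unfolding diff_lift_open[OF C(1)] by blast
    ultimately have "(x has_vector_derivative w) (at t)"
      by (metis C(1) has_vector_derivative_transform_within_open tC)
    then show ?thesis by blast
  next
    case False
    then have lim: "t islimpt E" using t by (simp add: U_def)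
    obtain u w where u: "\<And>s. orb G (x\<^sub>0 s) (u s)" "(u has_vector_derivative w) (at t)"
      using pw[OF t] by (auto simp: pointwise_lift_def)
    have freq: "\<exists>\<^sub>F s in at t. s \<in> E"
      using lim by (simp add: islimpt_conv_frequently_at)
    \<comment> \<open>For parameters in \<open>E\<close> the value of \<open>u\<close> is fixed by
      \<open>G\<close>, and these accumulate at \<open>t\<close>; thus value and derivative of
      \<open>g *v u s - u s\<close> vanish at \<open>t\<close>.\<close>
    have fixed: "g *v u t = u t" "g *v w = w" if g: "g \<in> G" for g
    proof -
      have "((\<lambda>s. g *v u s - u s) has_vector_derivative g *v w - w) (at t)"
        by (intro has_vector_derivative_diff u(2) has_vector_derivative_matrix_mult)
      moreover have "\<exists>\<^sub>F s in at t. g *v u s - u s = 0"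
        using freq
      proof (rule frequently_elim1)
        fix s assume "s \<in> E"
        then have "u s = x\<^sub>0 s" "g *v x\<^sub>0 s = x\<^sub>0 s" using u(1)[of s] g by (auto simp: E_def orb_def)
        then show "g *v u s - u s = 0" by simp
      qed
      ultimately have "g *v u t - u t = 0" "g *v w - w = 0"
        by (rule vector_derivative_frequently_zero)+
      then show "g *v u t = u t" "g *v w = w" by simp_all
    qed
    have "orb G (u s) (x s)" for s using u(1) lift orb_sym[OF G] orb_trans[OF G] by blast
    then obtain k where k: "\<And>s. k s \<in> G" "\<And>s. x s = k s *v u s" unfolding orb_def by metis
    obtain M where M: "M > 0" "\<And>g x. g \<in> G \<Longrightarrow> norm (g *v x) \<le> M * norm x"
      using finite_matrix_set_bound[OF finite_matrix_group_finite[OF G]] by blast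
    \<comment> \<open>Since \<open>u t\<close> and \<open>w\<close> are fixed, \<open>k s\<close>
      acts on the error alone, which grows at most by the factor \<open>M\<close> however
      erratically \<open>k s\<close> varies.\<close>
    have xq: "(x s - x t) /\<^sub>R (s - t) - w = k s *v ((u s - u t) /\<^sub>R (s - t) - w)" for s
      using fixed k by (simp add: matrix_vector_mult_diff_distrib matrix_vector_mult_scaleR_complex)
    have "((\<lambda>s. (u s - u t) /\<^sub>R (s - t)) \<longlongrightarrow> w) (at t)"
      using u(2) by (simp add: has_vector_derivative_quotient)
    then have "((\<lambda>s. M * norm ((u s - u t) /\<^sub>R (s - t) - w)) \<longlongrightarrow> 0) (at t)"
      by (auto intro!: tendsto_mult_right_zero tendsto_norm_zero simp: LIM_zero_iff)
    then have "((\<lambda>s. (x s - x t) /\<^sub>R (s - t) - w) \<longlongrightarrow> 0) (at t)"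
      by (rule Lim_null_comparison[rotated]) (unfold xq, intro always_eventually allI M(2) k(1))
    then have "(x has_vector_derivative w) (at t)"
      by (simp add: has_vector_derivative_quotient LIM_zero_iff)
    then show ?thesis by blast
  qed
  with lift have "diff_lift G x\<^sub>0 I x" unfolding diff_lift_open[OF I] by blast
  then show ?case by blast
qed

section \<open>Invariant polynomials\<close>

text \<open>Common form of \<open>in_alg\<close>, \<open>poly_fun\<close> and \<open>hom_poly_fun\<close>: \<open>Q\<close> restricts
  the admissible exponents.\<close>
definition poly_in ::
  "(('i \<Rightarrow> nat) \<Rightarrow> bool) \<Rightarrow> 'i set \<Rightarrow> ('i \<Rightarrow> 'v \<Rightarrow> complex) \<Rightarrow> ('v \<Rightarrow> complex) \<Rightarrow> bool" where
  "poly_in Q A f h \<longleftrightarrow> (\<exists>B b. finite B \<and> (\<forall>\<beta>\<in>B. Q \<beta>) \<and>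
      h = (\<lambda>x. \<Sum>\<beta>\<in>B. b \<beta> * (\<Prod>i\<in>A. f i x ^ \<beta> i)))"

lemma in_alg_iff: "in_alg A f h \<longleftrightarrow> poly_in (\<lambda>_. True) A f h"
  by (simp add: in_alg_def poly_in_def)

lemma poly_fun_iff: "poly_fun h \<longleftrightarrow> in_alg UNIV (\<lambda>i x. x $ i) h"
  by (simp add: poly_fun_def in_alg_def monom_def)

lemma hom_poly_fun_iff:
  "hom_poly_fun d h \<longleftrightarrow> poly_in (\<lambda>\<alpha>. sum \<alpha> UNIV = d) UNIV (\<lambda>i x. x $ i) h"
  by (simp add: hom_poly_fun_def poly_in_def monom_def)

text \<open>The exponent map \<open>\<phi>\<close> need not be injective: coefficients of equal
  exponents are collected. Sums can thus be indexed by a disjoint union and products by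
  pairs.\<close>

lemma poly_inI:
  assumes K: "finite K" and Q: "\<And>k. k \<in> K \<Longrightarrow> Q (\<phi> k)"
    and h: "\<And>x. h x = (\<Sum>k\<in>K. c k * (\<Prod>i\<in>A. f i x ^ \<phi> k i))"
  shows "poly_in Q A f h"
  unfolding poly_in_def
proof (intro exI conjI)
  show "finite (\<phi> ` K)" using K by simp
  show "\<forall>\<beta>\<in>\<phi> ` K. Q \<beta>" using Q by blast
  show "h = (\<lambda>x. \<Sum>\<beta>\<in>\<phi> ` K. (\<Sum>k\<in>{k \<in> K. \<phi> k = \<beta>}. c k) * (\<Prod>i\<in>A. f i x ^ \<beta> i))"
    by (rule ext, subst h, subst sum.image_gen[OF K, of _ \<phi>]) (auto simp: sum_distrib_right intro!: sum.cong)
qed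

lemma poly_in_const: "Q (\<lambda>_. 0) \<Longrightarrow> poly_in Q A f (\<lambda>_. c)"
  by (rule poly_inI[where K="{()}" and \<phi>="\<lambda>_ _. 0" and c="\<lambda>_. c"]) auto

lemma poly_in_zero: "poly_in Q A f (\<lambda>_. 0)"
  by (rule poly_inI[where K="{}"]) auto

lemma poly_in_gen:
  assumes "finite A" "i \<in> A" "Q (\<lambda>j. if j = i then 1 else 0)"
  shows "poly_in Q A f (f i)"
proof (rule poly_inI[where K="{()}" and \<phi>="\<lambda>_ j. if j = i then 1 else 0" and c="\<lambda>_. 1"])
  fix x
  have "(\<Prod>j\<in>A. f j x ^ (if j = i then 1 else 0)) = (\<Prod>j\<in>A. if j = i then f j x else 1)"
    by (rule prod.cong) auto
  then show "f i x = (\<Sum>k\<in>{()}. 1 * (\<Prod>j\<in>A. f j x ^ (if j = i then 1 else 0)))"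
    using assms(1,2) by simp
qed (use assms in auto)

lemma poly_in_add:
  assumes "poly_in Q A f h" "poly_in Q A f k"
  shows "poly_in Q A f (\<lambda>x. h x + k x)"
proof -
  obtain B b where B: "finite B" "\<forall>\<beta>\<in>B. Q \<beta>" "h = (\<lambda>x. \<Sum>\<beta>\<in>B. b \<beta> * (\<Prod>i\<in>A. f i x ^ \<beta> i))"
    using assms(1) by (auto simp: poly_in_def)
  obtain C c where C: "finite C" "\<forall>\<beta>\<in>C. Q \<beta>" "k = (\<lambda>x. \<Sum>\<beta>\<in>C. c \<beta> * (\<Prod>i\<in>A. f i x ^ \<beta> i))"
    using assms(2) by (auto simp: poly_in_def)
  show ?thesis
    by (rule poly_inI[where K="B <+> C" and \<phi>="case_sum id id" and c="case_sum b c"])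
      (use B C in \<open>auto simp: sum.Plus\<close>)
qed

text \<open>Three predicates, because in products of homogeneous polynomials the degrees
  add.\<close>

lemma poly_in_mult:
  assumes "poly_in Q A f h" "poly_in R A f k" "\<And>\<beta> \<gamma>. Q \<beta> \<Longrightarrow> R \<gamma> \<Longrightarrow> S (\<lambda>i. \<beta> i + \<gamma> i)"
  shows "poly_in S A f (\<lambda>x. h x * k x)"
proof -
  obtain B b where B: "finite B" "\<forall>\<beta>\<in>B. Q \<beta>" "h = (\<lambda>x. \<Sum>\<beta>\<in>B. b \<beta> * (\<Prod>i\<in>A. f i x ^ \<beta> i))"
    using assms(1) by (auto simp: poly_in_def)
  obtain C c where C: "finite C" "\<forall>\<beta>\<in>C. R \<beta>" "k = (\<lambda>x. \<Sum>\<beta>\<in>C. c \<beta> * (\<Prod>i\<in>A. f i x ^ \<beta> i))"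
    using assms(2) by (auto simp: poly_in_def)
  show ?thesis
    by (rule poly_inI[where K="B \<times> C" and \<phi>="\<lambda>(\<beta>, \<gamma>) i. \<beta> i + \<gamma> i" and c="\<lambda>(\<beta>, \<gamma>). b \<beta> * c \<gamma>"])
      (use B C assms(3) in \<open>auto simp: sum_product sum.cartesian_product power_add prod.distrib
        algebra_simps intro!: sum.cong\<close>)
qed

lemma poly_in_cmult: "poly_in Q A f h \<Longrightarrow> poly_in Q A f (\<lambda>x. c * h x)"
  by (rule poly_in_mult[where Q="\<lambda>\<beta>. \<beta> = (\<lambda>_. 0)" and R=Q, OF poly_in_const]) auto

lemma poly_in_sum:
  "(\<And>k. k \<in> K \<Longrightarrow> poly_in Q A f (h k)) \<Longrightarrow> poly_in Q A f (\<lambda>x. \<Sum>k\<in>K. h k x)"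
  by (induction K rule: infinite_finite_induct) (auto intro: poly_in_zero poly_in_add)

lemma in_alg_const: "in_alg A f (\<lambda>_. c)"
  by (simp add: in_alg_iff poly_in_const)

lemma in_alg_gen: "finite A \<Longrightarrow> i \<in> A \<Longrightarrow> in_alg A f (f i)"
  by (simp add: in_alg_iff poly_in_gen)

lemma in_alg_add: "in_alg A f h \<Longrightarrow> in_alg A f k \<Longrightarrow> in_alg A f (\<lambda>x. h x + k x)"
  by (simp add: in_alg_iff poly_in_add)

lemma in_alg_mult: "in_alg A f h \<Longrightarrow> in_alg A f k \<Longrightarrow> in_alg A f (\<lambda>x. h x * k x)"
  unfolding in_alg_iff by (rule poly_in_mult)

lemma in_alg_diff: "in_alg A f h \<Longrightarrow> in_alg A f k \<Longrightarrow> in_alg A f (\<lambda>x. h x - k x)"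
  using in_alg_add[OF _ in_alg_mult[OF in_alg_const[where c="-1"]], of A f h k] by simp

lemma in_alg_sum: "(\<And>k. k \<in> K \<Longrightarrow> in_alg A f (h k)) \<Longrightarrow> in_alg A f (\<lambda>x. \<Sum>k\<in>K. h k x)"
  by (simp add: in_alg_iff poly_in_sum)

lemma in_alg_prod: "(\<And>k. k \<in> K \<Longrightarrow> in_alg A f (h k)) \<Longrightarrow> in_alg A f (\<lambda>x. \<Prod>k\<in>K. h k x)"
  by (induction K rule: infinite_finite_induct) (auto intro: in_alg_const in_alg_mult)

lemma in_alg_power: "in_alg A f h \<Longrightarrow> in_alg A f (\<lambda>x. h x ^ n)"
  by (induction n) (auto intro: in_alg_const in_alg_mult)

lemma in_alg_trans:
  assumes "in_alg A f h" "\<And>i. i \<in> A \<Longrightarrow> in_alg B g (f i)"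
  shows "in_alg B g h"
proof -
  obtain C c where C: "finite C" "h = (\<lambda>x. \<Sum>\<beta>\<in>C. c \<beta> * (\<Prod>i\<in>A. f i x ^ \<beta> i))"
    using assms(1) by (auto simp: in_alg_def)
  show ?thesis
    unfolding C(2) by (intro in_alg_sum in_alg_mult in_alg_const in_alg_prod in_alg_power assms(2))
qed

lemma in_alg_cong_point:
  "in_alg A f h \<Longrightarrow> (\<And>i. i \<in> A \<Longrightarrow> f i x = f i y) \<Longrightarrow> h x = h y"
  by (auto simp: in_alg_def)

lemma poly_fun_coord: "poly_fun (\<lambda>x. x $ i)"
  unfolding poly_fun_iff using in_alg_gen[of UNIV i "\<lambda>i x. x $ i"] by simp

lemma poly_fun_matrix_coord: "poly_fun (\<lambda>x. (g *v x) $ i)" for g :: "complex^'n^'n"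
  unfolding poly_fun_iff matrix_vector_mult_def vec_lambda_beta
  by (intro in_alg_sum in_alg_mult in_alg_const poly_fun_coord[unfolded poly_fun_iff])

lemma poly_fun_compose_matrix:
  fixes g :: "complex^'n^'n"
  assumes "poly_fun f"
  shows "poly_fun (\<lambda>x. f (g *v x))"
proof -
  obtain A a where "finite A" "f = (\<lambda>x. \<Sum>\<alpha>\<in>A. a \<alpha> * monom \<alpha> x)"
    using assms by (auto simp: poly_fun_def)
  then show ?thesis
    unfolding poly_fun_iff monom_def
    by (auto intro!: in_alg_sum in_alg_mult in_alg_const in_alg_prod in_alg_power
        poly_fun_matrix_coord[unfolded poly_fun_iff])
qed

lemma continuous_on_poly_fun: "poly_fun f \<Longrightarrow> continuous_on S f"
  by (auto simp: poly_fun_def monom_def intro!: continuous_intros)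

lemma hom_poly_fun_imp_poly_fun: "hom_poly_fun d f \<Longrightarrow> poly_fun f"
  by (auto simp: hom_poly_fun_def poly_fun_def)

lemma hom_poly_fun_const: "hom_poly_fun 0 (\<lambda>_. c)"
  by (simp add: hom_poly_fun_iff poly_in_const)

lemma hom_poly_fun_coord: "hom_poly_fun 1 (\<lambda>x. x $ i)"
  unfolding hom_poly_fun_iff by (rule poly_in_gen) auto

lemma hom_poly_fun_mult:
  "hom_poly_fun d f \<Longrightarrow> hom_poly_fun e g \<Longrightarrow> hom_poly_fun (d + e) (\<lambda>x. f x * g x)"
  unfolding hom_poly_fun_iff by (erule (1) poly_in_mult) (simp add: sum.distrib)

lemma hom_poly_fun_cmult: "hom_poly_fun d f \<Longrightarrow> hom_poly_fun d (\<lambda>x. c * f x)"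
  by (simp add: hom_poly_fun_iff poly_in_cmult)

lemma hom_poly_fun_sum:
  "(\<And>k. k \<in> K \<Longrightarrow> hom_poly_fun d (f k)) \<Longrightarrow> hom_poly_fun d (\<lambda>x. \<Sum>k\<in>K. f k x)"
  by (simp add: hom_poly_fun_iff poly_in_sum)

lemma hom_poly_fun_power: "hom_poly_fun d f \<Longrightarrow> hom_poly_fun (n * d) (\<lambda>x. f x ^ n)"
  by (induction n) (auto intro: hom_poly_fun_const hom_poly_fun_mult)

lemma hom_poly_fun_prod:
  "(\<And>k. k \<in> K \<Longrightarrow> hom_poly_fun (d k) (f k)) \<Longrightarrow> hom_poly_fun (sum d K) (\<lambda>x. \<Prod>k\<in>K. f k x)"
  by (induction K rule: infinite_finite_induct) (auto intro: hom_poly_fun_const hom_poly_fun_mult)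

lemma hom_poly_fun_matrix_coord: "hom_poly_fun 1 (\<lambda>x. (g *v x) $ i)" for g :: "complex^'n^'n"
  unfolding matrix_vector_mult_def vec_lambda_beta
  by (intro hom_poly_fun_sum hom_poly_fun_cmult hom_poly_fun_coord)

lemma hom_poly_fun_monom_matrix:
  fixes g :: "complex^'n^'n"
  shows "hom_poly_fun (sum \<alpha> UNIV) (\<lambda>x. monom \<alpha> (g *v x))"
proof -
  have "hom_poly_fun (\<Sum>i\<in>UNIV. \<alpha> i * 1) (\<lambda>x. monom \<alpha> (g *v x))"
    unfolding monom_def by (intro hom_poly_fun_prod hom_poly_fun_power hom_poly_fun_matrix_coord)
  then show ?thesis by simp
qed

lemma of_real_smult: "complex_of_real r *s x = r *\<^sub>R x"
  unfolding vec_eq_iff vector_smult_component vector_scaleR_component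
  by (simp add: scaleR_conv_of_real)

lemma hom_poly_fun_scale:
  assumes "hom_poly_fun d f"
  shows "f (c *s x) = c ^ d * f x"
proof -
  obtain A a where A: "finite A" "\<And>\<alpha>. \<alpha> \<in> A \<Longrightarrow> sum \<alpha> UNIV = d" "f = (\<lambda>x. \<Sum>\<alpha>\<in>A. a \<alpha> * monom \<alpha> x)"
    using assms by (auto simp: hom_poly_fun_def)
  have "monom \<alpha> (c *s x) = c ^ d * monom \<alpha> x" if "\<alpha> \<in> A" for \<alpha>
    unfolding A(2)[OF that, symmetric]
    by (simp add: monom_def power_mult_distrib prod.distrib power_sum)
  then show ?thesis
    unfolding A(3) by (simp add: sum_distrib_left algebra_simps)
qed

text \<open>A nonzero homogeneous polynomial has just one degree, as scaling by 2 shows, so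
  \<open>hdeg\<close> is that degree. The zero polynomial is homogeneous of every degree and
  \<open>hdeg\<close> is unspecified, but then both sides vanish.\<close>

lemma hom_poly_fun_scale_hdeg:
  assumes "hom_poly_fun d f"
  shows "f (c *s x) = c ^ hdeg f * f x"
proof (cases "\<forall>y. f y = 0")
  case False
  then obtain y where y: "f y \<noteq> 0" by blast
  have "e = d" if "hom_poly_fun e f" for e
  proof -
    have "(2::complex) ^ e = 2 ^ d"
      using hom_poly_fun_scale[OF assms, of 2 y] hom_poly_fun_scale[OF that, of 2 y] y by simp
    then have "norm ((2::complex) ^ e) = norm ((2::complex) ^ d)" by simp
    then show ?thesis by (simp add: norm_power)
  qed
  then have "hdeg f = d" unfolding hdeg_def by (rule the_equality[where P="\<lambda>d. hom_poly_fun d f", OF assms])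
  with hom_poly_fun_scale[OF assms] show ?thesis by simp
qed simp

section \<open>Generators of the invariants as coordinates on the orbit space\<close>

lemma hom_gens_finite: "hom_gens G A f \<Longrightarrow> finite A"
  and hom_gens_inv: "hom_gens G A f \<Longrightarrow> i \<in> A \<Longrightarrow> inv_poly G (f i)"
  and hom_gens_hom: "hom_gens G A f \<Longrightarrow> i \<in> A \<Longrightarrow> \<exists>d. hom_poly_fun d (f i)"
  and hom_gens_gen: "hom_gens G A f \<Longrightarrow> inv_poly G h \<Longrightarrow> in_alg A f h"
  by (auto simp: hom_gens_def)

lemma hom_gens_continuous: "hom_gens G A f \<Longrightarrow> i \<in> A \<Longrightarrow> continuous_on S (f i)"
  by (drule (1) hom_gens_inv) (simp add: inv_poly_def continuous_on_poly_fun)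

lemma hom_gens_orb: "hom_gens G A f \<Longrightarrow> orb G x y \<Longrightarrow> i \<in> A \<Longrightarrow> f i y = f i x"
  by (drule (1) hom_gens_inv) (auto simp: inv_poly_def orb_def)

lemma group_translate_bij:
  assumes G: "finite_matrix_group G" and h: "h \<in> G"
  shows "bij_betw (\<lambda>g. g ** h) G G"
proof (rule finite_matrix_group_inverse[OF G h])
  fix k assume k: "k \<in> G" "k ** h = mat 1" "h ** k = mat 1"
  show ?thesis
    by (rule bij_betwI[where g="\<lambda>g. g ** k"])
      (use k h finite_matrix_group_mult[OF G] in \<open>auto simp flip: matrix_mul_assoc\<close>)
qed

lemma poly_fun_separates:
  assumes "finite F" "x \<notin> F"
  shows "\<exists>p. poly_fun p \<and> p x = 0 \<and> (\<forall>y\<in>F. p y = 1)"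
  using assms
proof (induction F)
  case empty
  then show ?case using in_alg_const by (auto simp: poly_fun_iff intro: exI[of _ "\<lambda>_. 0"])
next
  case (insert b F)
  then obtain p where p: "poly_fun p" "p x = 0" "\<forall>y\<in>F. p y = 1" by auto
  obtain i where i: "b $ i \<noteq> x $ i" using insert.prems by (metis insertI1 vec_eq_iff)
  define l where "l z = (z $ i - x $ i) * (1 / (b $ i - x $ i))" for z
  have l: "poly_fun l"
    unfolding l_def poly_fun_iff
    by (intro in_alg_mult in_alg_diff in_alg_const poly_fun_coord[unfolded poly_fun_iff])
  have l': "l x = 0" "l b = 1" using i by (simp_all add: l_def)
  \<comment> \<open>Takes the value 1 wherever \<open>p\<close> or \<open>l\<close> does, and 0
    where both vanish.\<close>
  define p' where "p' z = 1 - (1 - p z) * (1 - l z)" for z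
  have "poly_fun p'"
    unfolding p'_def poly_fun_iff
    by (intro in_alg_diff in_alg_mult in_alg_const p(1)[unfolded poly_fun_iff] l[unfolded poly_fun_iff])
  moreover have "p' x = 0" "\<forall>y\<in>insert b F. p' y = 1" using p l' by (auto simp: p'_def)
  ultimately show ?case by blast
qed

text \<open>Take a polynomial that is 0 at \<open>x\<close> and 1 on the orbit of \<open>y\<close>.
  The product of its translates over \<open>G\<close> is invariant, still 1 at \<open>y\<close>, and
  0 at \<open>x\<close> because of the factor for the identity; but it is a polynomial in the
  generators.\<close>

lemma hom_gens_separate:
  assumes G: "finite_matrix_group G" and f: "hom_gens G A f"
    and eq: "\<And>i. i \<in> A \<Longrightarrow> f i x = f i y"
  shows "orb G x y"
proof (rule ccontr)
  assume "\<not> orb G x y"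
  then have "x \<notin> (\<lambda>g. g *v y) ` G" using orb_sym[OF G] by (auto simp: orb_def)
  then obtain p where p: "poly_fun p" "p x = 0" "\<forall>z\<in>(\<lambda>g. g *v y) ` G. p z = 1"
    using poly_fun_separates finite_matrix_group_finite[OF G] by (metis finite_imageI)
  define q where "q z = (\<Prod>g\<in>G. p (g *v z))" for z
  have "q (h *v z) = q z" if h: "h \<in> G" for h z
    unfolding q_def using prod.reindex_bij_betw[OF group_translate_bij[OF G h], of "\<lambda>g. p (g *v z)"]
    by (simp add: matrix_vector_mul_assoc)
  moreover have "poly_fun q"
    unfolding q_def poly_fun_iff
    by (intro in_alg_prod poly_fun_compose_matrix[OF p(1), unfolded poly_fun_iff])
  ultimately have "inv_poly G q" by (simp add: inv_poly_def)
  then have "in_alg A f q" by (rule hom_gens_gen[OF f])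
  then have "q x = q y" by (rule in_alg_cong_point) (rule eq)
  moreover have "q x = 0"
    unfolding q_def using finite_matrix_group_finite[OF G] finite_matrix_group_one[OF G] p(2)
    by (intro prod_zero) (auto intro!: bexI[of _ "mat 1"])
  moreover have "q y = 1" unfolding q_def using p(3) by (intro prod.neutral) auto
  ultimately show False by simp
qed

text \<open>Properness. An unbounded sequence with bounded invariants, rescaled to the unit sphere,
  has a limit point \<open>l\<close> at which generators of positive degree vanish. Then
  \<open>l\<close> is not separated from 0, so it lies in the orbit of 0, which is absurd.\<close>

lemma hom_gens_bounded:
  assumes G: "finite_matrix_group G" and f: "hom_gens G A f"
  obtains R where "\<And>y. (\<And>i. i \<in> A \<Longrightarrow> norm (f i y) \<le> K) \<Longrightarrow> norm y \<le> R"
proof (rule ccontr)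
  assume "\<not> thesis"
  with that have "\<exists>y. (\<forall>i\<in>A. norm (f i y) \<le> K) \<and> norm y > real (Suc n)" for n
    by (metis linorder_not_le)
  then obtain Y where Y: "\<And>n i. i \<in> A \<Longrightarrow> norm (f i (Y n)) \<le> K" "\<And>n. norm (Y n) > real (Suc n)"
    by metis
  have pos: "norm (Y n) > 0" for n using Y(2)[of n] by linarith
  define u where "u n = complex_of_real (1 / norm (Y n)) *s Y n" for n
  have uY: "u n = (1 / norm (Y n)) *\<^sub>R Y n" for n
    unfolding u_def by (rule of_real_smult)
  have "norm (u n) = 1" for n using pos[of n] by (simp add: uY)
  then have "\<forall>n. u n \<in> sphere 0 1" by simp
  then obtain l r where l: "l \<in> sphere 0 1" "strict_mono r" "(u \<circ> r) \<longlonglongrightarrow> l"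
    using compact_sphere[of "0::complex^'a" 1] unfolding compact_def by meson
  have "f i l = f i 0" if i: "i \<in> A" for i
  proof -
    obtain d where d: "hom_poly_fun d (f i)" using hom_gens_hom[OF f i] by blast
    \<comment> \<open>This also settles constant generators, since \<open>0 ^ 0 = 1\<close>.\<close>
    have f0: "f i 0 = 0 ^ d * f i l" using hom_poly_fun_scale[OF d, of 0 l] by simp
    show ?thesis
    proof (cases "d = 0")
      case False
      have "(\<lambda>n. f i (u (r n))) \<longlonglongrightarrow> f i l"
        using continuous_on_tendsto_compose[OF hom_gens_continuous[OF f i, of UNIV] l(3)]
        by (simp add: o_def)
      moreover have "(\<lambda>n. f i (u (r n))) \<longlonglongrightarrow> 0"
      proof (rule Lim_null_comparison)
        show "(\<lambda>n. K * (1 / real (Suc n))) \<longlonglongrightarrow> 0"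
          using tendsto_mult_right_zero[OF LIMSEQ_inverse_real_of_nat, of K]
          by (simp add: inverse_eq_divide)
        have "norm (f i (u (r n))) \<le> K * (1 / real (Suc n))" for n
        proof -
          have "n \<le> r n" using l(2) by (rule seq_suble)
          then have ge: "norm (Y (r n)) \<ge> real (Suc n)" using Y(2)[of "r n"] by simp
          have "norm (Y (r n)) ^ d \<ge> norm (Y (r n)) ^ 1"
            using False ge by (intro power_increasing) auto
          then have "norm (Y (r n)) ^ d \<ge> real (Suc n)" using ge by simp
          then have "1 / norm (Y (r n)) ^ d \<le> 1 / real (Suc n)" by (intro divide_left_mono) auto
          moreover have "norm (f i (u (r n))) = norm (f i (Y (r n))) * (1 / norm (Y (r n)) ^ d)"
            unfolding u_def hom_poly_fun_scale[OF d] by (simp add: norm_mult norm_divide norm_power power_divide)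
          moreover have "0 \<le> K" using Y(1)[OF i, of "r n"] norm_ge_zero order_trans by blast
          ultimately show ?thesis
            using mult_mono[OF Y(1)[OF i, of "r n"], of "1 / norm (Y (r n)) ^ d" "1 / real (Suc n)"]
            by simp
        qed
        then show "\<forall>\<^sub>F n in sequentially. norm (f i (u (r n))) \<le> K * (1 / real (Suc n))" by simp
      qed
      ultimately have "f i l = 0" using LIMSEQ_unique by blast
      with f0 show ?thesis by simp
    qed (use f0 in simp)
  qed
  then have "orb G l 0" by (rule hom_gens_separate[OF G f])
  then have "orb G 0 l" by (rule orb_sym[OF G])
  then have "l = 0" by (auto simp: orb_def)
  with l(1) show False by simp
qed

text \<open>Points with nearly the same invariants have nearby orbits. A sequence of counterexamples
  is bounded by properness, and a limit point \<open>l\<close> has the invariants of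
  \<open>x\<close>; the element carrying \<open>l\<close> to \<open>x\<close> then brings members of
  the sequence near \<open>x\<close>.\<close>

lemma hom_gens_near:
  assumes G: "finite_matrix_group G" and f: "hom_gens G A f" and "\<epsilon> > 0"
  obtains \<delta> where "\<delta> > 0"
    "\<And>y. (\<And>i. i \<in> A \<Longrightarrow> norm (f i y - f i x) < \<delta>) \<Longrightarrow> \<exists>g\<in>G. norm (g *v y - x) < \<epsilon>"
proof (rule ccontr)
  assume contra: "\<not> thesis"
  have "\<exists>y. (\<forall>i\<in>A. norm (f i y - f i x) < 1 / real (Suc n)) \<and> (\<forall>g\<in>G. norm (g *v y - x) \<ge> \<epsilon>)" for n
  proof (rule ccontr)
    assume "\<not> ?thesis"
    then have "thesis" by (intro that[of "1 / real (Suc n)"]) (auto simp: not_le)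
    with contra show False by blast
  qed
  then obtain Y where Y: "\<And>n i. i \<in> A \<Longrightarrow> norm (f i (Y n) - f i x) < 1 / real (Suc n)"
      "\<And>n g. g \<in> G \<Longrightarrow> norm (g *v Y n - x) \<ge> \<epsilon>" by metis
  define K where "K = (\<Sum>i\<in>A. norm (f i x)) + 1"
  obtain R where R: "\<And>y. (\<And>i. i \<in> A \<Longrightarrow> norm (f i y) \<le> K) \<Longrightarrow> norm y \<le> R"
    using hom_gens_bounded[OF G f] by blast
  have "norm (Y n) \<le> R" for n
  proof (rule R)
    fix i assume i: "i \<in> A"
    have "norm (f i (Y n)) \<le> norm (f i x) + norm (f i (Y n) - f i x)" by norm
    also have "norm (f i (Y n) - f i x) \<le> 1"
      using Y(1)[OF i, of n] by (rule order_trans[OF less_imp_le]) simp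
    also have "norm (f i x) \<le> (\<Sum>i\<in>A. norm (f i x))"
      using i hom_gens_finite[OF f] by (intro member_le_sum) auto
    finally show "norm (f i (Y n)) \<le> K" by (simp add: K_def)
  qed
  then have "\<forall>n. Y n \<in> cball 0 R" by simp
  then obtain l r where l: "strict_mono r" "(Y \<circ> r) \<longlonglongrightarrow> l"
    using compact_cball[of "0::complex^'a" R] unfolding compact_def by meson
  have "f i l = f i x" if i: "i \<in> A" for i
  proof -
    have "(\<lambda>n. f i (Y (r n))) \<longlonglongrightarrow> f i l"
      using continuous_on_tendsto_compose[OF hom_gens_continuous[OF f i, of UNIV] l(2)]
      by (simp add: o_def)
    moreover have "(\<lambda>n. f i (Y (r n))) \<longlonglongrightarrow> f i x"
    proof (rule LIM_zero_cancel, rule Lim_null_comparison)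
      show "(\<lambda>n. 1 / real (Suc n)) \<longlonglongrightarrow> 0"
        using LIMSEQ_inverse_real_of_nat by (simp add: inverse_eq_divide)
      have "norm (f i (Y (r n)) - f i x) \<le> 1 / real (Suc n)" for n
      proof -
        have "n \<le> r n" using l(1) by (rule seq_suble)
        then have "1 / real (Suc (r n)) \<le> 1 / real (Suc n)" by (intro divide_left_mono) auto
        with Y(1)[OF i, of "r n"] show ?thesis by linarith
      qed
      then show "\<forall>\<^sub>F n in sequentially. norm (f i (Y (r n)) - f i x) \<le> 1 / real (Suc n)" by simp
    qed
    ultimately show ?thesis using LIMSEQ_unique by blast
  qed
  then have "orb G l x" by (rule hom_gens_separate[OF G f])
  then obtain g where g: "g \<in> G" "x = g *v l" by (auto simp: orb_def)
  have "(\<lambda>n. g *v Y (r n)) \<longlonglongrightarrow> x"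
    using bounded_linear.tendsto[OF matrix_vector_mul_bounded_linear l(2), of g] g(2) by (simp add: o_def)
  then have "\<forall>\<^sub>F n in sequentially. dist (g *v Y (r n)) x < \<epsilon>" using \<open>\<epsilon> > 0\<close> by (rule tendstoD)
  then have "\<forall>\<^sub>F n in sequentially. False"
    by eventually_elim (use Y(2)[OF g(1)] in \<open>auto simp: dist_norm not_less[symmetric]\<close>)
  then show False by simp
qed

section \<open>Finite generation of the invariant ring\<close>

context
  fixes G :: "(complex^'n^'n) set"
  assumes G: "finite_matrix_group G"
begin

text \<open>The coefficient of \<open>T\<^sup>k\<close> in the polynomial \<open>\<Prod>\<^bsub>g\<in>G\<^esub> (T - (g z)\<^sub>i)\<close>.\<close>
definition orbit_coeff :: "'n \<Rightarrow> nat \<Rightarrow> complex^'n \<Rightarrow> complex" where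
  "orbit_coeff i k z = (\<Sum>X\<in>{X. X \<subseteq> G \<and> card X = k}. \<Prod>g\<in>G - X. - ((g *v z) $ i))"

text \<open>The average of a monomial over the group, without the factor
  \<open>1 / card G\<close>.\<close>

definition orbit_sum :: "('n \<Rightarrow> nat) \<Rightarrow> complex^'n \<Rightarrow> complex" where
  "orbit_sum \<alpha> z = (\<Sum>g\<in>G. monom \<alpha> (g *v z))"

text \<open>Right translation by \<open>h\<close> permutes the \<open>k\<close>-element subsets of
  \<open>G\<close> and is compatible with complements.\<close>

lemma orbit_coeff_invariant:
  assumes h: "h \<in> G"
  shows "orbit_coeff i k (h *v z) = orbit_coeff i k z"
proof -
  let ?t = "\<lambda>g. g ** h"
  note bij = group_translate_bij[OF G h]
  have inj: "inj_on ?t G" and im: "?t ` G = G" using bij by (auto simp: bij_betw_def)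
  have "bij_betw ((`) ?t) {X. X \<subseteq> G \<and> card X = k} {X. X \<subseteq> G \<and> card X = k}"
  proof (rule bij_betw_imageI)
    show "inj_on ((`) ?t) {X. X \<subseteq> G \<and> card X = k}"
      by (rule inj_on_subset[OF inj_on_image_Pow[OF inj]]) auto
    show "(`) ?t ` {X. X \<subseteq> G \<and> card X = k} = {X. X \<subseteq> G \<and> card X = k}"
    proof (intro equalityI subsetI)
      fix Y assume "Y \<in> (`) ?t ` {X. X \<subseteq> G \<and> card X = k}"
      then obtain X where X: "X \<subseteq> G" "card X = k" "Y = ?t ` X" by auto
      then have "card Y = k" using card_image[OF inj_on_subset[OF inj X(1)]] by simp
      with X im show "Y \<in> {X. X \<subseteq> G \<and> card X = k}" by blast
    next
      fix Y assume Y: "Y \<in> {X. X \<subseteq> G \<and> card X = k}"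
      then have "Y \<subseteq> ?t ` G" using im by simp
      then obtain X where X: "X \<subseteq> G" "Y = ?t ` X" by (rule subset_imageE)
      moreover have "card X = k" using card_image[OF inj_on_subset[OF inj X(1)]] X Y by simp
      ultimately show "Y \<in> (`) ?t ` {X. X \<subseteq> G \<and> card X = k}" by blast
    qed
  qed
  then have "orbit_coeff i k z =
      (\<Sum>X\<in>{X. X \<subseteq> G \<and> card X = k}. \<Prod>g\<in>G - ?t ` X. - ((g *v z) $ i))"
    unfolding orbit_coeff_def by (rule sum.reindex_bij_betw[symmetric])
  also have "\<dots> = orbit_coeff i k (h *v z)"
    unfolding orbit_coeff_def
  proof (rule sum.cong[OF refl])
    fix X assume "X \<in> {X. X \<subseteq> G \<and> card X = k}"
    then have X: "X \<subseteq> G" by simp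
    have "bij_betw ?t (G - X) (G - ?t ` X)"
      using inj im X by (auto simp: bij_betw_def inj_on_diff inj_on_image_set_diff[OF inj])
    then show "(\<Prod>g\<in>G - ?t ` X. - ((g *v z) $ i)) = (\<Prod>g\<in>G - X. - ((g *v (h *v z)) $ i))"
      by (subst prod.reindex_bij_betw[symmetric]) (simp_all add: matrix_vector_mul_assoc)
  qed
  finally show ?thesis by simp
qed

lemma orbit_coeff_hom: "hom_poly_fun (card G - k) (orbit_coeff i k)"
proof -
  have "hom_poly_fun (card G - k) (\<lambda>z. \<Prod>g\<in>G - X. - ((g *v z) $ i))"
    if X: "X \<subseteq> G" "card X = k" for X
  proof -
    have "hom_poly_fun (\<Sum>g\<in>G - X. 1) (\<lambda>z. \<Prod>g\<in>G - X. (-1) * ((g *v z) $ i))"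
      by (intro hom_poly_fun_prod hom_poly_fun_cmult hom_poly_fun_matrix_coord)
    moreover have "card (G - X) = card G - k"
      using X finite_matrix_group_finite[OF G] by (metis card_Diff_subset finite_subset)
    ultimately show ?thesis by simp
  qed
  then show ?thesis unfolding orbit_coeff_def by (intro hom_poly_fun_sum) auto
qed

lemma orbit_sum_invariant: "h \<in> G \<Longrightarrow> orbit_sum \<alpha> (h *v z) = orbit_sum \<alpha> z"
  unfolding orbit_sum_def
  using sum.reindex_bij_betw[OF group_translate_bij[OF G], of h "\<lambda>g. monom \<alpha> (g *v z)"]
  by (simp add: matrix_vector_mul_assoc)

lemma orbit_sum_hom: "hom_poly_fun (sum \<alpha> UNIV) (orbit_sum \<alpha>)"
  unfolding orbit_sum_def by (intro hom_poly_fun_sum hom_poly_fun_monom_matrix)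

text \<open>Each coordinate is a root of its orbit polynomial, because the factor of the identity
  vanishes. That polynomial is monic of degree \<open>card G\<close>, so the top power can be solved
  for.\<close>

lemma orbit_coeff_relation:
  "(z $ i) ^ card G = - (\<Sum>k<card G. orbit_coeff i k z * (z $ i) ^ k)"
proof -
  have fin: "finite G" by (rule finite_matrix_group_finite[OF G])
  have "(0::complex) = (\<Prod>g\<in>G. z $ i + - ((g *v z) $ i))"
    by (rule sym, rule prod_zero[OF fin]) (auto intro!: bexI[OF _ finite_matrix_group_one[OF G]])
  also have "\<dots> = (\<Sum>X\<in>Pow G. (\<Prod>g\<in>X. z $ i) * (\<Prod>g\<in>G - X. - ((g *v z) $ i)))"
    by (rule prod_add[OF fin])
  also have "\<dots> = (\<Sum>k\<in>{..card G}. \<Sum>X\<in>{X \<in> Pow G. card X = k}. (\<Prod>g\<in>X. z $ i) * (\<Prod>g\<in>G - X. - ((g *v z) $ i)))"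
    by (rule sum.group[symmetric]) (use fin in \<open>auto intro: card_mono\<close>)
  also have "\<dots> = (\<Sum>k\<in>{..card G}. orbit_coeff i k z * (z $ i) ^ k)"
    unfolding orbit_coeff_def sum_distrib_right by (intro sum.cong refl) auto
  also have "\<dots> = (\<Sum>k<card G. orbit_coeff i k z * (z $ i) ^ k) + orbit_coeff i (card G) z * (z $ i) ^ card G"
    by (simp add: lessThan_Suc_atMost[symmetric])
  also have "orbit_coeff i (card G) z = 1"
  proof -
    have "{X. X \<subseteq> G \<and> card X = card G} = {G}" using card_subset_eq[OF fin] by blast
    then show ?thesis by (simp add: orbit_coeff_def)
  qed
  finally show ?thesis by (simp add: eq_neg_iff_add_eq_0 add.commute)
qed

definition exponent_box :: "('n \<Rightarrow> nat) set" where
  "exponent_box = {\<alpha>. \<forall>i. \<alpha> i < card G}"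

text \<open>A set of functions serving as its own index set, with the family
  \<open>\<lambda>h. h\<close>; renumbering is postponed to \<open>hom_gens_reindex\<close>.\<close>

definition coeff_gens :: "(complex^'n \<Rightarrow> complex) set" where
  "coeff_gens = (\<lambda>(i, k). orbit_coeff i k) ` (UNIV \<times> {..<card G})"

text \<open>The module spanned by finitely many monomials over the algebra of the orbit
  coefficients; it turns out to contain every polynomial, which is the integrality of the polynomial
  ring over the invariants.\<close>

definition box_module :: "(complex^'n \<Rightarrow> complex) \<Rightarrow> bool" where
  "box_module p \<longleftrightarrow> (\<exists>a. (\<forall>\<alpha>. in_alg coeff_gens (\<lambda>h. h) (a \<alpha>)) \<and>
      p = (\<lambda>z. \<Sum>\<alpha>\<in>exponent_box. a \<alpha> z * monom \<alpha> z))"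

lemma finite_exponent_box: "finite exponent_box"
proof -
  have "exponent_box = (\<Pi>\<^sub>E i\<in>UNIV. {..<card G})" by (auto simp: exponent_box_def)
  then show ?thesis by (simp add: finite_PiE)
qed

lemma finite_coeff_gens: "finite coeff_gens"
  by (simp add: coeff_gens_def)

lemma box_module_add: "box_module p \<Longrightarrow> box_module q \<Longrightarrow> box_module (\<lambda>z. p z + q z)"
proof -
  assume "box_module p" "box_module q"
  then obtain a b where "\<And>\<alpha>. in_alg coeff_gens (\<lambda>h. h) (a \<alpha>)" "p = (\<lambda>z. \<Sum>\<alpha>\<in>exponent_box. a \<alpha> z * monom \<alpha> z)"
    "\<And>\<alpha>. in_alg coeff_gens (\<lambda>h. h) (b \<alpha>)" "q = (\<lambda>z. \<Sum>\<alpha>\<in>exponent_box. b \<alpha> z * monom \<alpha> z)"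
    unfolding box_module_def by blast
  then show ?thesis
    unfolding box_module_def
    by (intro exI[of _ "\<lambda>\<alpha> z. a \<alpha> z + b \<alpha> z"]) (auto intro: in_alg_add simp: algebra_simps sum.distrib)
qed

lemma box_module_smult:
  "in_alg coeff_gens (\<lambda>h. h) c \<Longrightarrow> box_module p \<Longrightarrow> box_module (\<lambda>z. c z * p z)"
proof -
  assume c: "in_alg coeff_gens (\<lambda>h. h) c" and "box_module p"
  then obtain a where "\<And>\<alpha>. in_alg coeff_gens (\<lambda>h. h) (a \<alpha>)" "p = (\<lambda>z. \<Sum>\<alpha>\<in>exponent_box. a \<alpha> z * monom \<alpha> z)"
    unfolding box_module_def by blast
  with c show ?thesis
    unfolding box_module_def
    by (intro exI[of _ "\<lambda>\<alpha> z. c z * a \<alpha> z"]) (auto intro: in_alg_mult simp: algebra_simps sum_distrib_left)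
qed

lemma box_module_monom: "\<beta> \<in> exponent_box \<Longrightarrow> box_module (monom \<beta>)"
proof -
  assume \<beta>: "\<beta> \<in> exponent_box"
  have "(if \<alpha> = \<beta> then 1 else 0) * monom \<alpha> z = (if \<alpha> = \<beta> then monom \<alpha> z else 0)" for \<alpha> z by simp
  then show ?thesis
    unfolding box_module_def using \<beta> finite_exponent_box
    by (intro exI[of _ "\<lambda>\<alpha> z. if \<alpha> = \<beta> then 1 else 0"]) (auto intro: in_alg_const)
qed

lemma box_module_zero: "box_module (\<lambda>_. 0)"
  unfolding box_module_def by (intro exI[of _ "\<lambda>_ _. 0"]) (auto intro: in_alg_const)

lemma box_module_sum:
  "(\<And>k. k \<in> K \<Longrightarrow> box_module (p k)) \<Longrightarrow> box_module (\<lambda>z. \<Sum>k\<in>K. p k z)"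
  by (induction K rule: infinite_finite_induct) (auto intro: box_module_zero box_module_add)

lemma monom_split: "monom \<alpha> z = (z $ i) ^ \<alpha> i * (\<Prod>j\<in>UNIV - {i}. (z $ j) ^ \<alpha> j)"
  unfolding monom_def by (rule prod.remove) auto

lemma monom_upd: "monom (\<alpha>(i := k)) z = (z $ i) ^ k * (\<Prod>j\<in>UNIV - {i}. (z $ j) ^ \<alpha> j)"
  unfolding monom_split[of "\<alpha>(i := k)" z i] by (auto intro!: prod.cong)

text \<open>Multiplication by a coordinate raises one exponent. It leaves the box only on reaching
  \<open>card G\<close>, and then the orbit relation rewrites that power by lower ones.\<close>

lemma box_module_coord_mult:
  assumes "box_module p"
  shows "box_module (\<lambda>z. z $ i * p z)"
proof -
  have mon: "box_module (\<lambda>z. z $ i * monom \<alpha> z)" if \<alpha>: "\<alpha> \<in> exponent_box" for \<alpha>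
  proof (cases "Suc (\<alpha> i) < card G")
    case True
    have "(\<lambda>z. z $ i * monom \<alpha> z) = monom (\<alpha>(i := Suc (\<alpha> i)))"
      by (rule ext) (simp add: monom_upd monom_split[of \<alpha> _ i])
    moreover have "\<alpha>(i := Suc (\<alpha> i)) \<in> exponent_box" using \<alpha> True by (auto simp: exponent_box_def)
    ultimately show ?thesis using box_module_monom by simp
  next
    case False
    moreover have "\<alpha> i < card G" using \<alpha> by (simp add: exponent_box_def)
    ultimately have c: "Suc (\<alpha> i) = card G" by simp
    have "z $ i * monom \<alpha> z = (\<Sum>k<card G. (- 1 * orbit_coeff i k z) * monom (\<alpha>(i := k)) z)" for z
    proof -
      have "z $ i * monom \<alpha> z = (z $ i) ^ card G * (\<Prod>j\<in>UNIV - {i}. (z $ j) ^ \<alpha> j)"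
        by (simp add: monom_split[of \<alpha> _ i] flip: c)
      then show ?thesis
        unfolding orbit_coeff_relation monom_upd by (simp add: sum_distrib_right sum_negf mult.assoc)
    qed
    moreover have "box_module (\<lambda>z. \<Sum>k<card G. (- 1 * orbit_coeff i k z) * monom (\<alpha>(i := k)) z)"
    proof (intro box_module_sum box_module_smult box_module_monom in_alg_mult in_alg_const)
      fix k assume k: "k \<in> {..<card G}"
      then have "orbit_coeff i k \<in> coeff_gens" by (auto simp: coeff_gens_def)
      then show "in_alg coeff_gens (\<lambda>h. h) (orbit_coeff i k)"
        using in_alg_gen[OF finite_coeff_gens, of "orbit_coeff i k" "\<lambda>h. h"] by simp
      show "\<alpha>(i := k) \<in> exponent_box" using \<alpha> k by (auto simp: exponent_box_def)
    qed
    ultimately show ?thesis by simp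
  qed
  obtain a where a: "\<And>\<alpha>. in_alg coeff_gens (\<lambda>h. h) (a \<alpha>)" "p = (\<lambda>z. \<Sum>\<alpha>\<in>exponent_box. a \<alpha> z * monom \<alpha> z)"
    using assms unfolding box_module_def by blast
  have "(\<lambda>z. z $ i * p z) = (\<lambda>z. \<Sum>\<alpha>\<in>exponent_box. a \<alpha> z * (z $ i * monom \<alpha> z))"
    unfolding a(2) by (simp add: sum_distrib_left algebra_simps)
  then show ?thesis
    using box_module_sum[OF box_module_smult[OF a(1) mon]] by simp
qed

lemma poly_fun_box_module:
  assumes "poly_fun p"
  shows "box_module p"
proof -
  have pow: "box_module (\<lambda>z. (z $ i) ^ k * q z)" if "box_module q" for i k q
    using that by (induction k) (auto simp: mult.assoc intro: box_module_coord_mult)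
  have prod: "box_module (\<lambda>z. \<Prod>i\<in>S. (z $ i) ^ \<alpha> i)" if "finite S" for S \<alpha>
    using that
  proof (induction S)
    case empty
    \<comment> \<open>Puts the zero exponent, that is the constant 1, into the box.\<close>
    have "card G > 0"
      using finite_matrix_group_finite[OF G] finite_matrix_group_one[OF G] by (auto simp: card_gt_0_iff)
    then have "box_module (monom (\<lambda>_. 0))" by (intro box_module_monom) (simp add: exponent_box_def)
    moreover have "monom (\<lambda>_. 0) = (\<lambda>z::complex^'n. 1)" by (rule ext) (simp add: monom_def)
    ultimately show ?case by simp
  next
    case (insert i S)
    then show ?case using pow by simp
  qed
  obtain A a where "p = (\<lambda>x. \<Sum>\<alpha>\<in>A. a \<alpha> * monom \<alpha> x)"
    using assms by (auto simp: poly_fun_def)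
  then show ?thesis
    using prod unfolding monom_def by (auto intro!: box_module_sum box_module_smult in_alg_const)
qed

text \<open>Averaging over \<open>G\<close> is linear over the invariants, so it turns a representation in the box
  module into one by the generators.\<close>
lemma hom_gens_orbit: "hom_gens G (coeff_gens \<union> orbit_sum ` exponent_box) (\<lambda>h. h)"
  unfolding hom_gens_def
proof (intro conjI ballI allI impI)
  let ?A = "coeff_gens \<union> orbit_sum ` exponent_box"
  show fin: "finite ?A" using finite_coeff_gens finite_exponent_box by simp
  fix h assume h: "h \<in> ?A"
  have inv: "\<And>g x. g \<in> G \<Longrightarrow> h (g *v x) = h x"
    using h orbit_coeff_invariant orbit_sum_invariant by (auto simp: coeff_gens_def)
  show hom: "\<exists>d. hom_poly_fun d h"
    using h orbit_coeff_hom orbit_sum_hom by (auto simp: coeff_gens_def)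
  show "inv_poly G h" using inv hom hom_poly_fun_imp_poly_fun by (auto simp: inv_poly_def)
next
  let ?A = "coeff_gens \<union> orbit_sum ` exponent_box"
  have fin: "finite ?A" using finite_coeff_gens finite_exponent_box by simp
  fix p assume p: "inv_poly G p"
  obtain a where a: "\<And>\<alpha>. in_alg coeff_gens (\<lambda>h. h) (a \<alpha>)" "p = (\<lambda>z. \<Sum>\<alpha>\<in>exponent_box. a \<alpha> z * monom \<alpha> z)"
    using poly_fun_box_module p unfolding box_module_def inv_poly_def by blast
  have a_inv: "a \<alpha> (g *v z) = a \<alpha> z" if "g \<in> G" for \<alpha> g z
    by (rule in_alg_cong_point[OF a(1)]) (use that orbit_coeff_invariant in \<open>auto simp: coeff_gens_def\<close>)
  have cG: "of_nat (card G) \<noteq> (0::complex)"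
    using finite_matrix_group_finite[OF G] finite_matrix_group_one[OF G] by auto
  have "p z = (1 / of_nat (card G)) * (\<Sum>\<alpha>\<in>exponent_box. a \<alpha> z * orbit_sum \<alpha> z)" for z
  proof -
    have "of_nat (card G) * p z = (\<Sum>g\<in>G. p (g *v z))" using p by (simp add: inv_poly_def)
    also have "\<dots> = (\<Sum>g\<in>G. \<Sum>\<alpha>\<in>exponent_box. a \<alpha> z * monom \<alpha> (g *v z))"
      by (intro sum.cong refl) (simp add: a(2) a_inv)
    also have "\<dots> = (\<Sum>\<alpha>\<in>exponent_box. a \<alpha> z * orbit_sum \<alpha> z)"
      unfolding orbit_sum_def sum_distrib_left by (rule sum.swap)
    finally show ?thesis using cG by (simp add: field_simps)
  qed
  then have p_eq: "p = (\<lambda>z. (1 / of_nat (card G)) * (\<Sum>\<alpha>\<in>exponent_box. a \<alpha> z * orbit_sum \<alpha> z))" by (rule ext)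
  have "in_alg ?A (\<lambda>h. h) (a \<alpha>)" for \<alpha>
    by (rule in_alg_trans[OF a(1)]) (use in_alg_gen[OF fin, of _ "\<lambda>h. h"] in simp)
  moreover have "in_alg ?A (\<lambda>h. h) (orbit_sum \<alpha>)" if "\<alpha> \<in> exponent_box" for \<alpha>
    using in_alg_gen[OF fin, of "orbit_sum \<alpha>" "\<lambda>h. h"] that by simp
  ultimately show "in_alg ?A (\<lambda>h. h) p"
    unfolding p_eq by (intro in_alg_mult in_alg_const in_alg_sum)
qed

end

section \<open>Existence of minimal systems of generators\<close>

lemma hom_gens_reindex:
  assumes f: "hom_gens G B f" and \<phi>: "bij_betw \<phi> C B"
  shows "hom_gens G C (\<lambda>j. f (\<phi> j))"
  unfolding hom_gens_def
proof (intro conjI ballI allI impI)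
  show fin: "finite C" using \<phi> hom_gens_finite[OF f] bij_betw_finite by blast
  show "inv_poly G (f (\<phi> j))" "\<exists>d. hom_poly_fun d (f (\<phi> j))" if "j \<in> C" for j
    using that hom_gens_inv[OF f] hom_gens_hom[OF f] bij_betwE[OF \<phi>] by blast+
  fix h assume "inv_poly G h"
  show "in_alg C (\<lambda>j. f (\<phi> j)) h"
  proof (rule in_alg_trans[OF hom_gens_gen[OF f \<open>inv_poly G h\<close>]])
    fix i assume "i \<in> B"
    then obtain j where "j \<in> C" "i = \<phi> j" using \<phi> by (auto simp: bij_betw_def)
    then show "in_alg C (\<lambda>j. f (\<phi> j)) (f i)" using in_alg_gen[OF fin, of j "\<lambda>j. f (\<phi> j)"] by simp
  qed
qed

text \<open>A system of least cardinality is minimal under inclusion: a proper subset that still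
  generates could be renumbered to a shorter system.\<close>

lemma ex_min_hom_gens:
  fixes G :: "(complex^'n^'n) set"
  assumes G: "finite_matrix_group G"
  obtains m :: nat and \<tau> where "min_hom_gens G {..<m} \<tau>"
proof -
  define P where "P m \<longleftrightarrow> (\<exists>\<tau>. hom_gens G {..<m::nat} \<tau>)" for m
  have P: "P (card B)" if f: "hom_gens G B f" for B :: "'i set" and f
  proof -
    obtain \<phi> where "bij_betw \<phi> {..<card B} B"
      using ex_bij_betw_nat_finite[OF hom_gens_finite[OF f]] by (auto simp: atLeast0LessThan)
    then show ?thesis unfolding P_def using hom_gens_reindex[OF f] by blast
  qed
  define m where "m = (LEAST m. P m)"
  have "P m" unfolding m_def using P[OF hom_gens_orbit[OF G]] by (rule LeastI)
  then obtain \<tau> where \<tau>: "hom_gens G {..<m} \<tau>" by (auto simp: P_def)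
  have "\<not> hom_gens G B \<tau>" if B: "B \<subset> {..<m}" for B
  proof
    assume "hom_gens G B \<tau>"
    then have "m \<le> card B" unfolding m_def using P by (intro Least_le)
    moreover have "card B < m" using psubset_card_mono[OF _ B] by simp
    ultimately show False by simp
  qed
  with \<tau> have "min_hom_gens G {..<m} \<tau>" by (auto simp: min_hom_gens_def)
  with that show ?thesis .
qed

section \<open>Slice charts and flatness\<close>

lemma hom_gens_vec_continuous:
  fixes \<sigma> :: "complex^'n \<Rightarrow> complex^'m"
  assumes "hom_gens G (UNIV :: 'm set) (\<lambda>i x. \<sigma> x $ i)"
  shows "continuous_on S \<sigma>"
  using continuous_on_vec_lambda[of S "\<lambda>i x. \<sigma> x $ i"] hom_gens_continuous[OF assms] by simp

lemma hom_gens_vec_eq_iff: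
  fixes \<sigma> :: "complex^'n \<Rightarrow> complex^'m"
  assumes G: "finite_matrix_group G" and \<sigma>: "hom_gens G (UNIV :: 'm set) (\<lambda>i x. \<sigma> x $ i)"
  shows "\<sigma> x = \<sigma> y \<longleftrightarrow> orb G x y"
proof
  assume "\<sigma> x = \<sigma> y"
  then show "orb G x y" by (intro hom_gens_separate[OF G \<sigma>]) simp
next
  assume "orb G x y"
  then show "\<sigma> x = \<sigma> y" using hom_gens_orb[OF \<sigma>] by (simp add: vec_eq_iff)
qed

text \<open>On \<open>S\<close> the fibres of \<open>tauvec m \<tau>\<close> and of
  \<open>\<sigma> (v + x)\<close> are the same, namely orbits of the isotropy group, so both maps
  have the same quotient. Continuity of the two comparison maps comes from
  \<open>hom_gens_near\<close>, applied to the isotropy group for \<open>\<Phi>\<close> and to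
  \<open>G\<close> for \<open>\<Psi>\<close>.\<close>

lemma ex_slice_chart:
  fixes \<sigma> :: "complex^'n \<Rightarrow> complex^'m"
  assumes G: "finite_matrix_group G" and \<sigma>: "hom_gens G (UNIV :: 'm set) (\<lambda>i x. \<sigma> x $ i)"
    and \<tau>: "hom_gens (stab G v) {..<m} \<tau>"
  obtains S \<Phi> \<Psi> where "slice_chart G \<sigma> v m \<tau> S \<Phi> \<Psi>"
proof -
  define H where "H = stab G v"
  have H: "finite_matrix_group H" unfolding H_def by (rule finite_matrix_group_stab[OF G])
  have finH: "finite H" by (rule finite_matrix_group_finite[OF H])
  note \<tau> = \<tau>[folded H_def]
  note \<sigma>_eq = hom_gens_vec_eq_iff[OF G \<sigma>]
  obtain r where r: "r > 0"
    "\<And>g x. g \<in> G \<Longrightarrow> norm (x - v) < r \<Longrightarrow> norm (g *v x - v) < r \<Longrightarrow> g *v v = v"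
    using slice_radius[OF finite_matrix_group_finite[OF G]] by blast
  \<comment> \<open>The ball of radius \<open>r\<close> need not be invariant under
    \<open>H\<close>; this is its largest invariant part.\<close>
  define S where "S = {x. \<forall>h\<in>H. norm (h *v x) < r}"
  have "S = (\<Inter>h\<in>H. {x. norm (h *v x) < r})" by (auto simp: S_def)
  moreover have "open {x. norm (h *v x) < r}" for h :: "complex^'n^'n"
    by (intro open_Collect_less continuous_intros linear_continuous_on) simp
  ultimately have openS: "open S" using finH by (simp add: open_INT)
  have S0: "0 \<in> S" using r(1) by (simp add: S_def)
  have Sinv: "h *v x \<in> S" if "h \<in> H" "x \<in> S" for h x
    using that finite_matrix_group_mult[OF H] by (auto simp: S_def matrix_vector_mul_assoc)
  have Sr: "norm x < r" if "x \<in> S" for x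
    using that finite_matrix_group_one[OF H] by (force simp: S_def)
  have Hv: "h *v (v + x) = v + h *v x" if "h \<in> H" for h x
    using that by (simp add: H_def stab_def matrix_vector_right_distrib)
  have H_orb: "\<sigma> (v + x) = \<sigma> (v + y)" if "orb H x y" for x y
    using that Hv stab_subset[of G v] unfolding \<sigma>_eq orb_def H_def[symmetric] by (metis subsetD)
  have G_orb: "orb H x y" if xS: "x \<in> S" and yS: "y \<in> S" and eq: "\<sigma> (v + x) = \<sigma> (v + y)" for x y
  proof -
    obtain g where g: "g \<in> G" "v + y = g *v (v + x)" using eq by (auto simp: \<sigma>_eq orb_def)
    then have "g *v v = v" using r(2)[OF g(1), of "v + x"] Sr[OF xS] Sr[OF yS]
      by (simp flip: g(2))
    then have gH: "g \<in> H" using g(1) by (simp add: H_def stab_def)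
    then have "y = g *v x" using g(2) Hv[OF gH] by simp
    with gH show ?thesis by (auto simp: orb_def)
  qed
  let ?T = "tauvec m \<tau>"
  have T_eq: "?T x = ?T y \<longleftrightarrow> orb H x y" for x y
  proof
    assume *: "?T x = ?T y"
    show "orb H x y"
    proof (rule hom_gens_separate[OF H \<tau>])
      show "\<tau> i x = \<tau> i y" if "i \<in> {..<m}" for i
        using fun_cong[OF *, of i] that by (simp add: tauvec_def)
    qed
  next
    assume "orb H x y"
    then show "?T x = ?T y" using hom_gens_orb[OF \<tau>] by (auto simp: tauvec_def)
  qed
  \<comment> \<open>Any representative in \<open>S\<close> will do: by \<open>H_orb\<close> and
    \<open>G_orb\<close> the values of \<open>\<Phi>\<close> and \<open>\<Psi>\<close> do not depend
    on it.\<close>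
  define \<Phi> where "\<Phi> p = \<sigma> (v + (SOME x. x \<in> S \<and> ?T x = p))" for p
  define \<Psi> where "\<Psi> q = ?T (SOME x. x \<in> S \<and> \<sigma> (v + x) = q)" for q
  have \<Phi>: "\<Phi> (?T x) = \<sigma> (v + x)" if "x \<in> S" for x
  proof -
    have "(SOME y. y \<in> S \<and> ?T y = ?T x) \<in> S \<and> ?T (SOME y. y \<in> S \<and> ?T y = ?T x) = ?T x"
      by (rule someI[of "\<lambda>y. y \<in> S \<and> ?T y = ?T x"]) (use that in simp)
    then show ?thesis unfolding \<Phi>_def by (intro H_orb) (simp add: T_eq)
  qed
  have \<Psi>: "\<Psi> (\<sigma> (v + x)) = ?T x" if "x \<in> S" for x
  proof -
    have "(SOME y. y \<in> S \<and> \<sigma> (v + y) = \<sigma> (v + x)) \<in> S \<and>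
        \<sigma> (v + (SOME y. y \<in> S \<and> \<sigma> (v + y) = \<sigma> (v + x))) = \<sigma> (v + x)"
      by (rule someI[of "\<lambda>y. y \<in> S \<and> \<sigma> (v + y) = \<sigma> (v + x)"]) (use that in simp)
    then show ?thesis unfolding \<Psi>_def T_eq using that by (intro G_orb) auto
  qed
  define U where "U = (\<lambda>x. \<sigma> (v + x)) ` S"
  \<comment> \<open>Openness of \<open>\<sigma> (v + x)\<close> as a map from \<open>S\<close> into
    the range of \<open>\<sigma>\<close>. It yields both that \<open>U\<close> is open and that
    \<open>\<Psi>\<close> is continuous.\<close>
  have near: "\<exists>\<delta>>0. \<forall>z. dist (\<sigma> z) (\<sigma> (v + x)) < \<delta> \<longrightarrow>
      (\<exists>y\<in>S. dist y x < \<epsilon> \<and> \<sigma> z = \<sigma> (v + y))" if x: "x \<in> S" and "\<epsilon> > 0" for x \<epsilon>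
  proof -
    obtain \<epsilon>' where \<epsilon>': "\<epsilon>' > 0" "ball x \<epsilon>' \<subseteq> S" using openS x open_contains_ball_eq by meson
    obtain \<delta> where \<delta>: "\<delta> > 0" "\<And>z. (\<And>i. i \<in> UNIV \<Longrightarrow> norm (\<sigma> z $ i - \<sigma> (v + x) $ i) < \<delta>) \<Longrightarrow>
        \<exists>g\<in>G. norm (g *v z - (v + x)) < min \<epsilon> \<epsilon>'"
      using hom_gens_near[OF G \<sigma>, of "min \<epsilon> \<epsilon>'" "v + x"] \<open>\<epsilon> > 0\<close> \<epsilon>'(1) by auto
    have "\<exists>y\<in>S. dist y x < \<epsilon> \<and> \<sigma> z = \<sigma> (v + y)" if z: "dist (\<sigma> z) (\<sigma> (v + x)) < \<delta>" for z
    proof -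
      have "norm (\<sigma> z $ i - \<sigma> (v + x) $ i) < \<delta>" for i
        using z Finite_Cartesian_Product.norm_nth_le[of "\<sigma> z - \<sigma> (v + x)" i] by (simp add: dist_norm)
      then obtain g where g: "g \<in> G" "norm (g *v z - (v + x)) < min \<epsilon> \<epsilon>'" using \<delta>(2) by blast
      define y where "y = g *v z - v"
      have "dist y x < min \<epsilon> \<epsilon>'" using g(2) by (simp add: y_def dist_norm diff_diff_eq)
      then have "y \<in> S" "dist y x < \<epsilon>" using \<epsilon>'(2) by (auto simp: dist_commute)
      moreover have "\<sigma> z = \<sigma> (v + y)" using g(1) by (auto simp: \<sigma>_eq orb_def y_def)
      ultimately show ?thesis by blast
    qed
    with \<delta>(1) show ?thesis by blast
  qed
  have openU: "openin (top_of_set (range \<sigma>)) U"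
    unfolding openin_euclidean_subtopology_iff
  proof (intro conjI ballI)
    show "U \<subseteq> range \<sigma>" by (auto simp: U_def)
    fix q assume "q \<in> U"
    then obtain x where "x \<in> S" "q = \<sigma> (v + x)" by (auto simp: U_def)
    then show "\<exists>e>0. \<forall>q'\<in>range \<sigma>. dist q' q < e \<longrightarrow> q' \<in> U"
      using near[of x 1] unfolding U_def by fastforce
  qed
  have cont\<sigma>: "continuous_on UNIV \<sigma>" by (rule hom_gens_vec_continuous[OF \<sigma>])
  have cont\<Phi>: "continuous_on (?T ` S) \<Phi>"
    unfolding continuous_on
  proof (intro ballI tendstoI)
    fix p and e :: real assume "p \<in> ?T ` S" "e > 0"
    then obtain x where x: "x \<in> S" "p = ?T x" by auto
    obtain \<epsilon> where \<epsilon>: "\<epsilon> > 0" "\<And>z. dist z (v + x) < \<epsilon> \<Longrightarrow> dist (\<sigma> z) (\<sigma> (v + x)) < e"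
      using cont\<sigma> \<open>e > 0\<close> unfolding continuous_on_iff by (metis UNIV_I)
    obtain \<delta> where \<delta>: "\<delta> > 0"
      "\<And>y. (\<And>i. i \<in> {..<m} \<Longrightarrow> norm (\<tau> i y - \<tau> i x) < \<delta>) \<Longrightarrow> \<exists>g\<in>H. norm (g *v y - x) < \<epsilon>"
      using hom_gens_near[OF H \<tau> \<epsilon>(1), of x] by blast
    \<comment> \<open>The space of sequences carries the product topology, and closeness of the
      finitely many coordinates below \<open>m\<close> suffices.\<close>
    have coord: "\<forall>\<^sub>F q in at p within ?T ` S. dist (q i) (p i) < \<delta>" for i
    proof -
      have "((\<lambda>q. q i) \<longlongrightarrow> p i) (at p within ?T ` S)"
        using continuous_on_product_coordinates[of i] tendsto_within_subset
        unfolding continuous_on by blast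
      then show ?thesis using \<delta>(1) by (rule tendstoD)
    qed
    have "\<forall>\<^sub>F q in at p within ?T ` S. \<forall>i\<in>{..<m}. dist (q i) (p i) < \<delta>"
      by (rule eventually_ball_finite) (use coord in auto)
    moreover have "\<forall>\<^sub>F q in at p within ?T ` S. q \<in> ?T ` S" by (simp add: eventually_at_filter)
    ultimately show "\<forall>\<^sub>F q in at p within ?T ` S. dist (\<Phi> q) (\<Phi> p) < e"
    proof eventually_elim
      case (elim q)
      then obtain y where y: "y \<in> S" "q = ?T y" by auto
      have "norm (\<tau> i y - \<tau> i x) < \<delta>" if "i \<in> {..<m}" for i
        using elim(1) that unfolding y x by (force simp: tauvec_def dist_norm)
      then obtain h where h: "h \<in> H" "norm (h *v y - x) < \<epsilon>" using \<delta>(2) by blast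
      have "\<sigma> (v + y) = \<sigma> (v + h *v y)" using h(1) by (intro H_orb) (auto simp: orb_def)
      moreover have "dist (\<sigma> (v + h *v y)) (\<sigma> (v + x)) < e"
        using h(2) by (intro \<epsilon>(2)) (simp add: dist_norm)
      ultimately show ?case using \<Phi> x y by simp
    qed
  qed
  have cont\<Psi>: "continuous_on U \<Psi>"
  proof (rule continuous_on_coordinatewise_then_product)
    fix i
    show "continuous_on U (\<lambda>q. \<Psi> q i)"
    proof (cases "i < m")
      case False
      then show ?thesis by (simp add: \<Psi>_def tauvec_def)
    next
      case True
      then have cont\<tau>: "continuous_on UNIV (\<tau> i)" using hom_gens_continuous[OF \<tau>] by simp
      show ?thesis
        unfolding continuous_on_iff
      proof (intro ballI allI impI)
        fix q and e :: real assume "q \<in> U" "e > 0"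
        then obtain x where x: "x \<in> S" "q = \<sigma> (v + x)" by (auto simp: U_def)
        obtain \<epsilon> where \<epsilon>: "\<epsilon> > 0" "\<And>y. dist y x < \<epsilon> \<Longrightarrow> dist (\<tau> i y) (\<tau> i x) < e"
          using cont\<tau> \<open>e > 0\<close> unfolding continuous_on_iff by (metis UNIV_I)
        obtain \<delta> where \<delta>: "\<delta> > 0" "\<And>z. dist (\<sigma> z) (\<sigma> (v + x)) < \<delta> \<Longrightarrow>
            (\<exists>y\<in>S. dist y x < \<epsilon> \<and> \<sigma> z = \<sigma> (v + y))"
          using near[OF x(1) \<epsilon>(1)] by blast
        have "dist (\<Psi> q' i) (\<Psi> q i) < e" if "q' \<in> U" "dist q' q < \<delta>" for q'
        proof -
          obtain z where "q' = \<sigma> z" using \<open>q' \<in> U\<close> by (auto simp: U_def)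
          then obtain y where y: "y \<in> S" "dist y x < \<epsilon>" "q' = \<sigma> (v + y)" using \<delta>(2) \<open>dist q' q < \<delta>\<close> x(2) by blast
          show ?thesis
            using \<epsilon>(2)[OF y(2)] True unfolding y(3) x(2) \<Psi>[OF y(1)] \<Psi>[OF x(1)] by (simp add: tauvec_def)
        qed
        with \<delta>(1) show "\<exists>d>0. \<forall>q'\<in>U. dist q' q < d \<longrightarrow> dist (\<Psi> q' i) (\<Psi> q i) < e" by blast
      qed
    qed
  qed
  have homeo: "homeomorphism (?T ` S) U \<Phi> \<Psi>"
    by (rule homeomorphismI[OF cont\<Phi> cont\<Psi>]) (auto simp: U_def \<Phi> \<Psi>)
  have "\<sigma> v \<in> U" using S0 unfolding U_def by (metis (no_types, lifting) add.right_neutral image_eqI)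
  with openS S0 Sinv \<Phi> openU homeo have "slice_chart G \<sigma> v m \<tau> S \<Phi> \<Psi>"
    unfolding slice_chart_def H_def by blast
  with that show ?thesis .
qed

section \<open>1-flatness against differentiability of lifts\<close>

lemma isCont_Ck_on:
  assumes "Ck_on k I c" "open I" "t \<in> I"
  shows "isCont c t"
proof -
  obtain F where F: "\<forall>t\<in>I. F 0 t = c t"
    "\<forall>j<k. \<forall>t\<in>I. (F j has_vector_derivative F (Suc j) t) (at t)" "continuous_on I (F k)"
    using assms(1) by (auto simp: Ck_on_def)
  have "isCont (F 0) t"
  proof (cases k)
    case 0
    then show ?thesis using F(3) assms(2,3) continuous_on_eq_continuous_at by blast
  next
    case (Suc j)
    then show ?thesis using F(2) assms(3) has_vector_derivative_continuous by blast
  qed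
  moreover have "\<forall>\<^sub>F s in nhds t. F 0 s = c s"
    using F(1) assms(2,3) by (metis (mono_tags, lifting) eventually_nhds)
  ultimately show ?thesis using isCont_cong by blast
qed

text \<open>Translate the lift so that it passes through \<open>v\<close> and write its deviation
  from \<open>v\<close> as \<open>s - t\<close> times a continuous curve \<open>y\<close>.
  Homogeneity then pulls the power of \<open>s - t\<close> out of each generator, leaving the
  continuous factors \<open>\<tau> i (y s)\<close>.\<close>

lemma diff_lift_imp_one_flat:
  fixes \<sigma> :: "complex^'n \<Rightarrow> complex^'m"
  assumes G: "finite_matrix_group G" and \<sigma>: "hom_gens G (UNIV :: 'm set) (\<lambda>i x. \<sigma> x $ i)"
    and I: "open I" "t \<in> I" and cb: "\<And>t. t \<in> I \<Longrightarrow> cb differentiable (at t)"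
    and lift: "\<And>t. t \<in> I \<Longrightarrow> \<sigma> (cb t) = c t"
  shows "one_flat G \<sigma> I c t"
  unfolding one_flat_def
proof (intro allI impI)
  fix v m \<tau> S \<Phi> \<Psi>
  assume v: "\<sigma> v = c t" and \<tau>: "min_hom_gens (stab G v) {..<m} \<tau>"
    and chart: "slice_chart G \<sigma> v m \<tau> S \<Phi> \<Psi>"
  note \<tau> = \<tau>[unfolded min_hom_gens_def, THEN conjunct1]
  have S: "open S" "0 \<in> S" "\<And>x. x \<in> S \<Longrightarrow> \<Phi> (tauvec m \<tau> x) = \<sigma> (v + x)"
    using chart by (auto simp: slice_chart_def)
  obtain U where homeo: "homeomorphism (tauvec m \<tau> ` S) U \<Phi> \<Psi>"
    using chart by (auto simp: slice_chart_def)
  have "orb G (cb t) v" using v lift[OF I(2)] hom_gens_vec_eq_iff[OF G \<sigma>] by metis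
  then obtain g where g: "g \<in> G" "v = g *v cb t" by (auto simp: orb_def)
  define x where "x s = g *v cb s - v" for s
  have x_deriv: "\<exists>w. (x has_vector_derivative w) (at s)" if "s \<in> I" for s
  proof -
    have "(cb has_vector_derivative vector_derivative cb (at s)) (at s)"
      using cb[OF that] by (simp add: vector_derivative_works)
    from has_vector_derivative_diff_const[THEN iffD2, OF has_vector_derivative_matrix_mult[OF this]]
    show ?thesis unfolding x_def by blast
  qed
  have x_cont: "isCont x s" if "s \<in> I" for s
    using x_deriv[OF that] has_vector_derivative_continuous by blast
  have xt: "x t = 0" by (simp add: x_def g(2))
  have x_lift: "\<sigma> (v + x s) = c s" if "s \<in> I" for s
  proof -
    have "\<sigma> (cb s) = \<sigma> (g *v cb s)" using g(1) hom_gens_vec_eq_iff[OF G \<sigma>] by (auto simp: orb_def)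
    then show ?thesis using lift[OF that] by (simp add: x_def)
  qed
  obtain w where w: "(x has_vector_derivative w) (at t)" using x_deriv[OF I(2)] by blast
  \<comment> \<open>The difference quotient, completed at \<open>t\<close> by the derivative to make
    it continuous.\<close>
  define y where "y s = (if s = t then w else x s /\<^sub>R (s - t))" for s
  have xy: "x s = complex_of_real (s - t) *s y s" for s
    unfolding of_real_smult by (simp add: y_def xt)
  have "isCont y s" if s: "s \<in> I" for s
  proof (cases "s = t")
    case True
    have "((\<lambda>s. x s /\<^sub>R (s - t)) \<longlongrightarrow> w) (at t)"
      using w by (simp add: has_vector_derivative_quotient xt)
    then have "(y \<longlongrightarrow> w) (at t)"
      by (rule Lim_transform_eventually) (auto simp: eventually_at_filter y_def)
    then show ?thesis unfolding True continuous_at by (simp add: y_def)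
  next
    case False
    have "isCont (\<lambda>s. x s /\<^sub>R (s - t)) s"
      using False x_cont[OF s] by (intro continuous_intros) auto
    moreover have "\<forall>\<^sub>F p in nhds s. x p /\<^sub>R (p - t) = y p"
    proof -
      have "\<forall>\<^sub>F p in nhds s. p \<in> - {t}" using False by (intro eventually_nhds_in_open) auto
      then show ?thesis by eventually_elim (simp add: y_def)
    qed
    ultimately show ?thesis using isCont_cong[of "\<lambda>s. x s /\<^sub>R (s - t)" y s] by blast
  qed
  then have y_cont: "continuous_on I y" by (simp add: continuous_at_imp_continuous_on)
  obtain e where e: "e > 0" "\<And>s. dist s t < e \<Longrightarrow> x s \<in> S"
  proof -
    have "(x \<longlongrightarrow> 0) (at t)" using x_cont[OF I(2)] by (simp add: continuous_at xt)
    then have "\<forall>\<^sub>F s in at t. x s \<in> S" using S(1,2) by (rule topological_tendstoD)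
    then obtain d where "d > 0" "\<And>s. s \<noteq> t \<Longrightarrow> dist s t < d \<Longrightarrow> x s \<in> S"
      by (auto simp: eventually_at)
    with S(2) xt that[of d] show ?thesis by metis
  qed
  show "\<exists>e>0. \<exists>a :: nat \<Rightarrow> real \<Rightarrow> complex.
      (\<forall>i<m. continuous_on (ball t e \<inter> I) (a i)) \<and>
      (\<forall>s\<in>ball t e \<inter> I. \<Psi> (c s) =
         (\<lambda>i. if i < m then (complex_of_real (s - t)) ^ hdeg (\<tau> i) * a i s else 0))"
  proof (intro exI[of _ e] conjI exI[of _ "\<lambda>i s. \<tau> i (y s)"] allI impI ballI)
    fix i assume "i < m"
    then show "continuous_on (ball t e \<inter> I) (\<lambda>s. \<tau> i (y s))"
      by (intro continuous_on_compose2[OF hom_gens_continuous[OF \<tau>, of i UNIV]]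
          continuous_on_subset[OF y_cont]) auto
  next
    fix s assume s: "s \<in> ball t e \<inter> I"
    then have xS: "x s \<in> S" using e(2) by (simp add: dist_commute)
    have "\<Psi> (c s) = \<Psi> (\<Phi> (tauvec m \<tau> (x s)))" using S(3)[OF xS] x_lift s by simp
    also have "\<dots> = tauvec m \<tau> (x s)" using homeomorphism_apply1[OF homeo] xS by blast
    also have "\<dots> = (\<lambda>i. if i < m then complex_of_real (s - t) ^ hdeg (\<tau> i) * \<tau> i (y s) else 0)"
    proof
      fix i
      show "tauvec m \<tau> (x s) i = (if i < m then complex_of_real (s - t) ^ hdeg (\<tau> i) * \<tau> i (y s) else 0)"
      proof (cases "i < m")
        case True
        then obtain d where d: "hom_poly_fun d (\<tau> i)" using hom_gens_hom[OF \<tau>] by blast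
        have "\<tau> i (x s) = complex_of_real (s - t) ^ hdeg (\<tau> i) * \<tau> i (y s)"
          unfolding xy[of s] by (rule hom_poly_fun_scale_hdeg[OF d])
        with True show ?thesis by (simp add: tauvec_def)
      qed (simp add: tauvec_def)
    qed
    finally show "\<Psi> (c s) = (\<lambda>i. if i < m then complex_of_real (s - t) ^ hdeg (\<tau> i) * \<tau> i (y s) else 0)" .
  qed (rule e(1))
qed

text \<open>In the slice, divide a lift by \<open>s - t\<close>. The invariants of the quotient are
  the functions \<open>a i\<close>, which have a limit at \<open>t\<close>; by properness the limit
  is attained at some \<open>w\<close>, and elements of the isotropy group can move the quotients
  towards \<open>w\<close>, which becomes the derivative.\<close>

lemma one_flat_imp_pointwise_lift:
  fixes \<sigma> :: "complex^'n \<Rightarrow> complex^'m"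
  assumes G: "finite_matrix_group G" and \<sigma>: "hom_gens G (UNIV :: 'm set) (\<lambda>i x. \<sigma> x $ i)"
    and I: "open I" "t \<in> I" and c: "isCont c t" and x0: "\<And>s. s \<in> I \<Longrightarrow> \<sigma> (x\<^sub>0 s) = c s"
    and flat: "one_flat G \<sigma> I c t"
  shows "pointwise_lift G x\<^sub>0 t"
proof -
  define v where "v = x\<^sub>0 t"
  define H where "H = stab G v"
  have v: "\<sigma> v = c t" unfolding v_def by (rule x0[OF I(2)])
  have H: "finite_matrix_group H" unfolding H_def by (rule finite_matrix_group_stab[OF G])
  note finH = finite_matrix_group_finite[OF H]
  obtain m \<tau> where min\<tau>: "min_hom_gens H {..<m::nat} \<tau>" by (rule ex_min_hom_gens[OF H])
  then have \<tau>: "hom_gens H {..<m} \<tau>" by (simp add: min_hom_gens_def)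
  obtain S \<Phi> \<Psi> where chart: "slice_chart G \<sigma> v m \<tau> S \<Phi> \<Psi>"
    by (rule ex_slice_chart[OF G \<sigma> \<tau>[unfolded H_def]])
  obtain e a where e: "e > 0" and a: "\<And>i. i < m \<Longrightarrow> continuous_on (ball t e \<inter> I) (a i)"
    and a_eq: "\<And>s. s \<in> ball t e \<inter> I \<Longrightarrow> \<Psi> (c s) =
        (\<lambda>i. if i < m then complex_of_real (s - t) ^ hdeg (\<tau> i) * a i s else 0)"
    using flat[unfolded one_flat_def, rule_format, OF v min\<tau>[unfolded H_def] chart] by blast
  have \<Phi>: "\<And>x. x \<in> S \<Longrightarrow> \<Phi> (tauvec m \<tau> x) = \<sigma> (v + x)"
    using chart by (auto simp: slice_chart_def)
  obtain U where U: "openin (top_of_set (range \<sigma>)) U" "\<sigma> v \<in> U"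
    and homeo: "homeomorphism (tauvec m \<tau> ` S) U \<Phi> \<Psi>"
    using chart by (auto simp: slice_chart_def)
  obtain \<epsilon> where \<epsilon>: "\<epsilon> > 0" "\<And>q. q \<in> range \<sigma> \<Longrightarrow> dist q (c t) < \<epsilon> \<Longrightarrow> q \<in> U"
    using U v unfolding openin_euclidean_subtopology_iff by metis
  \<comment> \<open>Continuity of the curve keeps \<open>c s\<close> inside the domain
    \<open>U\<close> of the chart.\<close>
  obtain e1 where e1: "e1 > 0" "\<And>s. dist s t < e1 \<Longrightarrow> dist (c s) (c t) < \<epsilon>"
    using c \<epsilon>(1) unfolding continuous_at_eps_delta by blast
  obtain e2 where e2: "e2 > 0" "ball t e2 \<subseteq> I" using I open_contains_ball_eq by meson
  define B where "B = ball t (min e (min e1 e2))"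
  have B: "open B" "t \<in> B" "B \<subseteq> ball t e \<inter> I" "\<And>s. s \<in> B \<Longrightarrow> dist s t < e1"
    using e e1 e2 by (auto simp: B_def dist_commute)
  have "\<exists>x\<in>S. tauvec m \<tau> x = \<Psi> (c s) \<and> \<sigma> (v + x) = c s" if s: "s \<in> B" for s
  proof -
    have "c s \<in> range \<sigma>" using x0[of s] s B(3) by (metis IntD2 rangeI subsetD)
    then have cU: "c s \<in> U" using \<epsilon>(2) e1(2) B(4)[OF s] by blast
    then obtain x where x: "x \<in> S" "tauvec m \<tau> x = \<Psi> (c s)"
      using homeomorphism_image2[OF homeo] by (metis imageE imageI)
    then have "\<sigma> (v + x) = c s" using \<Phi>[OF x(1)] homeomorphism_apply2[OF homeo cU] by simp
    with x show ?thesis by blast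
  qed
  then obtain X where X: "\<And>s. s \<in> B \<Longrightarrow> tauvec m \<tau> (X s) = \<Psi> (c s)" "\<And>s. s \<in> B \<Longrightarrow> \<sigma> (v + X s) = c s"
    by metis
  define q where "q s = X s /\<^sub>R (s - t)" for s
  \<comment> \<open>By homogeneity both sides carry the same power of \<open>s - t\<close>, which
    cancels for \<open>s\<close> different from \<open>t\<close>.\<close>
  have \<tau>q: "\<tau> i (q s) = a i s" if s: "s \<in> B" "s \<noteq> t" and i: "i < m" for s i
  proof -
    have "X s = complex_of_real (s - t) *s q s" unfolding of_real_smult q_def using s(2) by simp
    moreover obtain d where "hom_poly_fun d (\<tau> i)" using hom_gens_hom[OF \<tau>] i by blast
    ultimately have "\<tau> i (X s) = complex_of_real (s - t) ^ hdeg (\<tau> i) * \<tau> i (q s)"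
      using hom_poly_fun_scale_hdeg by metis
    moreover have "\<tau> i (X s) = complex_of_real (s - t) ^ hdeg (\<tau> i) * a i s"
    proof -
      have "s \<in> ball t e \<inter> I" using s(1) B(3) by blast
      from fun_cong[OF a_eq[OF this], of i] fun_cong[OF X(1)[OF s(1)], of i] i
      show ?thesis by (simp add: tauvec_def)
    qed
    ultimately show ?thesis using s(2) by simp
  qed
  have a_lim: "(a i \<longlongrightarrow> a i t) (at t)" if "i < m" for i
  proof -
    have "continuous_on B (a i)" using a[OF that] B(3) by (rule continuous_on_subset)
    then show ?thesis using B(1,2) by (simp add: continuous_on_eq_continuous_at continuous_at)
  qed
  have evB: "\<forall>\<^sub>F s in at t. s \<in> B \<and> s \<noteq> t"
    using eventually_at_in_open[OF B(1,2)] by (auto elim: eventually_mono)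
  \<comment> \<open>Along \<open>t + 1 / (n + 1)\<close> the quotients have bounded invariants,
    hence are bounded, and a convergent subsequence provides \<open>w\<close>.\<close>
  obtain w where w: "\<And>i. i < m \<Longrightarrow> \<tau> i w = a i t"
  proof -
    define s where "s n = t + inverse (real (Suc n))" for n
    have "s \<longlonglongrightarrow> t" unfolding s_def using tendsto_add[OF tendsto_const LIMSEQ_inverse_real_of_nat, of t] by simp
    then have "filterlim s (at t) sequentially"
      unfolding filterlim_at by (auto simp: s_def)
    then have s_lim: "(\<lambda>n. a i (s n)) \<longlonglongrightarrow> a i t" if "i < m" for i
      using filterlim_compose[OF a_lim[OF that]] by blast
    have evs: "\<forall>\<^sub>F n in sequentially. s n \<in> B \<and> s n \<noteq> t"
      using evB \<open>filterlim s (at t) sequentially\<close> by (rule eventually_compose_filterlim)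
    define K where "K = (\<Sum>i<m. norm (a i t)) + 1"
    obtain R where R: "\<And>y. (\<And>i. i \<in> {..<m} \<Longrightarrow> norm (\<tau> i y) \<le> K) \<Longrightarrow> norm y \<le> R"
      using hom_gens_bounded[OF H \<tau>] by blast
    have "\<forall>\<^sub>F n in sequentially. \<forall>i\<in>{..<m}. dist (a i (s n)) (a i t) < 1"
      using s_lim by (intro eventually_ball_finite) (auto intro: tendstoD)
    with evs have "\<forall>\<^sub>F n in sequentially. norm (q (s n)) \<le> R \<and> (\<forall>i<m. \<tau> i (q (s n)) = a i (s n))"
    proof eventually_elim
      case (elim n)
      have eq: "\<tau> i (q (s n)) = a i (s n)" if "i < m" for i using \<tau>q elim(1) that by blast
      have "norm (q (s n)) \<le> R"
      proof (rule R)
        fix i assume i: "i \<in> {..<m}"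
        have "norm (a i (s n)) \<le> norm (a i t) + dist (a i (s n)) (a i t)"
          unfolding dist_norm by norm
        also have "norm (a i t) \<le> (\<Sum>i<m. norm (a i t))" using i by (intro member_le_sum) auto
        also have "dist (a i (s n)) (a i t) \<le> 1" using elim(2) i by (simp add: less_imp_le)
        finally show "norm (\<tau> i (q (s n))) \<le> K" using eq i by (simp add: K_def)
      qed
      with eq show ?case by blast
    qed
    then obtain N where N: "\<And>n. n \<ge> N \<Longrightarrow> norm (q (s n)) \<le> R"
        "\<And>n i. n \<ge> N \<Longrightarrow> i < m \<Longrightarrow> \<tau> i (q (s n)) = a i (s n)"
      by (auto simp: eventually_sequentially)
    have "\<forall>n. q (s (n + N)) \<in> cball 0 R" using N(1) by simp
    then obtain w r where r: "strict_mono r" "((\<lambda>n. q (s (n + N))) \<circ> r) \<longlonglongrightarrow> w"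
      using compact_cball[of "0::complex^'n" R] unfolding compact_def by meson
    have "\<tau> i w = a i t" if i: "i < m" for i
    proof (rule LIMSEQ_unique)
      show "(\<lambda>n. \<tau> i (q (s (r n + N)))) \<longlonglongrightarrow> \<tau> i w"
        using continuous_on_tendsto_compose[OF hom_gens_continuous[OF \<tau>, of i UNIV] r(2)] i
        by (simp add: o_def)
      have "(\<lambda>n. a i (s (r n + N))) \<longlonglongrightarrow> a i t"
        using LIMSEQ_subseq_LIMSEQ[OF LIMSEQ_ignore_initial_segment[OF s_lim[OF i], of N] r(1)]
        by (simp add: o_def)
      then show "(\<lambda>n. \<tau> i (q (s (r n + N)))) \<longlonglongrightarrow> a i t" using N(2) i by simp
    qed
    with that show ?thesis by blast
  qed
  \<comment> \<open>Taking the translate nearest to \<open>w\<close> makes one choice serve every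
    tolerance: if any element of \<open>H\<close> brings \<open>q s\<close> within a given distance
    of \<open>w\<close>, so does \<open>k s\<close>.\<close>
  have "\<exists>k\<in>H. \<forall>h\<in>H. norm (k *v q s - w) \<le> norm (h *v q s - w)" for s
    using ex_is_arg_min_if_finite[OF finH, of "\<lambda>h. norm (h *v q s - w)"] finite_matrix_group_one[OF H]
    by (auto simp: is_arg_min_linorder)
  then obtain k where k: "\<And>s. k s \<in> H" "\<And>s h. h \<in> H \<Longrightarrow> norm (k s *v q s - w) \<le> norm (h *v q s - w)"
    by metis
  have kq: "((\<lambda>s. k s *v q s) \<longlongrightarrow> w) (at t)"
  proof (rule tendstoI)
    fix \<eta> :: real assume "\<eta> > 0"
    obtain \<delta> where \<delta>: "\<delta> > 0"
      "\<And>y. (\<And>i. i \<in> {..<m} \<Longrightarrow> norm (\<tau> i y - \<tau> i w) < \<delta>) \<Longrightarrow> \<exists>g\<in>H. norm (g *v y - w) < \<eta>"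
      using hom_gens_near[OF H \<tau> \<open>\<eta> > 0\<close>, of w] by blast
    have "\<forall>\<^sub>F s in at t. \<forall>i\<in>{..<m}. dist (a i s) (a i t) < \<delta>"
      using a_lim \<delta>(1) by (intro eventually_ball_finite) (auto intro: tendstoD)
    with evB show "\<forall>\<^sub>F s in at t. dist (k s *v q s) w < \<eta>"
    proof eventually_elim
      case (elim s)
      have "norm (\<tau> i (q s) - \<tau> i w) < \<delta>" if "i \<in> {..<m}" for i
        using elim that w \<tau>q by (auto simp: dist_norm)
      then obtain g where "g \<in> H" "norm (g *v q s - w) < \<eta>" using \<delta>(2) by blast
      then show ?case using k(2)[of g s] by (simp add: dist_norm)
    qed
  qed
  \<comment> \<open>At \<open>t\<close> this is \<open>x\<^sub>0 t = v\<close>, so the difference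
    quotient is exactly \<open>k s *v q s\<close>; away from \<open>B\<close> any lift will
    do.\<close>
  define u where "u s = (if s \<in> B \<and> s \<noteq> t then v + k s *v X s else x\<^sub>0 s)" for s
  have "orb G (x\<^sub>0 s) (u s)" for s
  proof (cases "s \<in> B \<and> s \<noteq> t")
    case True
    have kG: "k s \<in> G" "k s *v v = v" using k(1)[of s] by (auto simp: H_def stab_def)
    then have "u s = k s *v (v + X s)" using True by (simp add: u_def matrix_vector_right_distrib)
    moreover have "orb G (x\<^sub>0 s) (v + X s)"
      using X(2) x0 True B(3) hom_gens_vec_eq_iff[OF G \<sigma>] by (metis IntD2 subsetD)
    ultimately show ?thesis using orb_translate[OF G kG(1)] by simp
  next
    case False
    then show ?thesis using orb_refl[OF G] by (auto simp: u_def)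
  qed
  moreover have "(u has_vector_derivative w) (at t)"
    unfolding has_vector_derivative_quotient
  proof (rule Lim_transform_eventually[OF kq])
    show "\<forall>\<^sub>F s in at t. k s *v q s = (u s - u t) /\<^sub>R (s - t)"
      using evB by eventually_elim (simp add: u_def v_def q_def matrix_vector_mult_scaleR_complex)
  qed
  ultimately show ?thesis by (auto simp: pointwise_lift_def)
qed

theorem theorem6p4:
  fixes G :: "(complex^'n::finite^'n) set"
    and \<sigma> :: "complex^'n \<Rightarrow> complex^'m::finite"
    and I :: "real set"
    and c :: "real \<Rightarrow> complex^'m"
  assumes "finite_matrix_group G"
    and "min_hom_gens G (UNIV :: 'm set) (\<lambda>i x. \<sigma> x $ i)"
    and "open I" and "is_interval I"
    and "Ck_on (D_max G) I c"
    and "\<forall>t\<in>I. c t \<in> range \<sigma>"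
  shows "(\<exists>cb :: real \<Rightarrow> complex^'n. (\<forall>t\<in>I. cb differentiable (at t)) \<and>
            (\<forall>t\<in>I. \<sigma> (cb t) = c t))
         \<longleftrightarrow> (\<forall>t\<in>I. one_flat G \<sigma> I c t)"
proof -
  note G = assms(1) and I = assms(3)
  have \<sigma>: "hom_gens G (UNIV :: 'm set) (\<lambda>i x. \<sigma> x $ i)"
    using assms(2) by (simp add: min_hom_gens_def)
  show ?thesis
  proof
    assume "\<exists>cb :: real \<Rightarrow> complex^'n. (\<forall>t\<in>I. cb differentiable (at t)) \<and> (\<forall>t\<in>I. \<sigma> (cb t) = c t)"
    then show "\<forall>t\<in>I. one_flat G \<sigma> I c t"
      using diff_lift_imp_one_flat[OF G \<sigma> I] by blast
  next
    assume flat: "\<forall>t\<in>I. one_flat G \<sigma> I c t"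
    \<comment> \<open>The reference choice: a preimage at each parameter of \<open>I\<close>,
      without regularity, and arbitrary outside \<open>I\<close>.\<close>
    have "\<exists>x. t \<in> I \<longrightarrow> \<sigma> x = c t" for t using assms(6) by (metis imageE)
    then obtain x\<^sub>0 where x0: "\<And>t. t \<in> I \<Longrightarrow> \<sigma> (x\<^sub>0 t) = c t" by metis
    have "pointwise_lift G x\<^sub>0 t" if "t \<in> I" for t
      using one_flat_imp_pointwise_lift[OF G \<sigma> I that isCont_Ck_on[OF assms(5) I that] x0] flat that by blast
    then obtain x where x: "diff_lift G x\<^sub>0 I x" using pointwise_lift_imp_diff_lift[OF G I] by blast
    have "\<sigma> (x t) = c t" if "t \<in> I" for t
      using x x0[OF that] hom_gens_vec_eq_iff[OF G \<sigma>] unfolding diff_lift_def by metis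
    moreover have "x differentiable (at t)" if "t \<in> I" for t
      using x that unfolding diff_lift_open[OF I] using differentiableI_vector by blast
    ultimately show "\<exists>cb :: real \<Rightarrow> complex^'n. (\<forall>t\<in>I. cb differentiable (at t)) \<and> (\<forall>t\<in>I. \<sigma> (cb t) = c t)"
      by blast
  qed
qed

end
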